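(* Let $\mathfrak R\subseteq\mathfrak R(d_*,L_*,s_* )$ be a cubical iterated graph system with replacement graphs $G_m$, equipped with the flipping symmetries $\eta_{t_j}:=\eta_j|_{S(\mathfrak R)}$, $j=1,\dots,d_*$. Let $p\in(1,\infty)$ and $q=\frac{p}{p-1}$. Then there is a constant $C_{\mathrm{FB}}>0$, independent of $m\in\mathbb N$ and of the type $t$, such that for every $m\in\mathbb N$ there exists a flow basis $\mathcal F^{(m)}$ of $\widetilde G_m$ with \[ \mathcal E_q(\mathcal F^{(m)})\le C_{\mathrm{FB}}\cdot\mathcal E_q\!\left(I_{t,-}^{(m)},I_{t,+}^{(m)},G_m\right)\quad\text{for all types }t. \]
   Context: Graphs: $(V,E)$, $V$ finite non-empty, $E\subseteq V\times V$, $(x,y)\in E\Rightarrow(y,x)\notin E$; $\{x,y\}\in E$ means either orientation. Flows: an antisymmetric $F:V\times V\to\mathbb R$ ($F(x,y)=-F(y,x)$, $F(x,y)=0$ unless $\{x,y\}\in E$) is a flow from $A$ to $B$ (disjoint non-empty) if $\operatorname{div}F(x):=\sum_{\{x,y\}\in E}F(x,y)=0$ for $x\notin A\cup B$; unit if $\sum_{x\in A}\operatorname{div}F(x)=1$; $\mathcal E_q(F)=\sum_{\{x,y\}\in E}|F(x,y)|^q$ (each edge once); $\mathcal E_q(A,B,G)=\inf\{\mathcal E_q(F): F$ unit flow from $A$ to $B$ in $G\}$. IGS $\mathfrak R$: connected graph $G_1=(S,E)$, finite type set $\mathcal T$, surjective typing $\mathfrak t:E\to\mathcal T$, non-empty gluing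 rules $I_t\subseteq S\times S$; $I_{t,+}$, $I_{t,-}$ are the sets of first, resp. second, coordinates of $I_t$, and $I_{t,\star}^{(m)}=(I_{t,\star})^m$. With $W_m=S^m$, $[w]_k=w_1\cdots w_k$, replacement graphs $G_m=(W_m,E_m)$: $(w,v)\in E_{m+1}$ iff (1) $[w]_m=[v]_m$ and $(w_{m+1},v_{m+1})\in E$ (type $\mathfrak t(w_{m+1},v_{m+1})$), or (2) $([w]_m,[v]_m)\in E_m$ and $(w_{m+1},v_{m+1})\in I_{\mathfrak t([w]_m,[v]_m)}$ (type $\mathfrak t([w]_m,[v]_m)$). Mapping of IGS $\varphi:\mathfrak R\to\mathfrak R'$: graph mapping $G_1\to G'_1$ (edges to edges or collapsed) with (i) if $\varphi(w_1)=\varphi(v_1)$ for an edge of type $t$ then $\varphi(w_2)=\varphi(v_2)$ for $(w_2,v_2)\in I_t$; (ii) if $(w_1,v_1)\in E$ of type $t$ and $(\varphi(w_1),\varphi(v_1))\in E'$ of type $t'$ then $(\varphi(w_2),\varphi(v_2))\in I'_{t'}$ for $(w_2,v_2)\in I_t$; (iii) if $(w_1,v_1)\in E$ of type $t$ and $(\varphi(v_1),\varphi(w_1))\in E'$ of type $t'$ then $(\varphi(v_2),\varphi(w_2))\in I'_{t'}$ for $(w_2,v_2)\in I_t$. Isomorphism of IGS: graph isomorphism with it and its inverse mappings of IGS; sub-system: $S\subseteq S'$, same types, inclusion a mapping of IGS. Cubical IGS: for integers $d_*\ge1,s_*\ge1,L_*\ge3$, $\mathfrak R(d_*,L_*,s_*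 )$ has symbols $\{1,\dots,L_*\}^{d_*}\times\{\underline1,\dots,\underline{s_*}\}$ with coordinates $c_i$, sheet $s$; types $t_1,\dots,t_{d_*}$; $(w,v)$ edge of type $t_j$ iff $c_i(v)=c_i(w)$ ($i\neq j$), $c_j(v)=c_j(w)+1$; $(w,v)\in I_{t_j}$ iff $c_i(w)=c_i(v)$ ($i\ne j$), $(c_j(w),c_j(v))=(L_*,1)$, $s(w)=s(v)$. Sheet- and other-coordinate-preserving maps: $\eta_j: c_j\mapsto L_*+1-c_j$; $\alpha^+_{j,k}$ ($j\neq k$) swaps $c_j,c_k$; $\alpha^-_{j,k}$: $c_k\mapsto L_*+1-c_j$, $c_j\mapsto L_*+1-c_k$; $\mathcal G$ the set of these. Cubical IGS: sub-system $\mathfrak R\subseteq\mathfrak R(d_*,L_*,s_* )$ with (C1) for each $j$, every symbol with $c_i\in\{1,L_*\}$ ($i\neq j$) and sheet $\underline1$ (condition $(\ast_j)$) is in $S(\mathfrak R)$; (C2) if $w,v$ satisfy $(\ast_j)$, agree off coordinate $j$, $c_j(v)=c_j(w)+1$, then $(w,v)\in E(\mathfrak R)$; (C3) if $w,v$ satisfy $(\ast_j)$, agree off coordinate $j$, $(c_j(w),c_j(v))=(L_*,1)$, then $(w,v)\in I_{t_j}(\mathfrak R)$; (C4) each $\alpha\in\mathcal G$ restricts to an isomorphism of IGS $\mathfrak R\to\mathfrak R$. Flipping symmetries act on $W_m$ letterwise: $\eta(w_1\cdots w_m)=\eta(w_1)\cdots\eta(w_m)$. Flow basis: let $\mathcal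 L^{(m)}=\{I_{t,\star}^{(m)}:t\in\mathcal T,\star\in\{+,-\}\}$ (a set, so equal sets are identified). $\widetilde G_m$ has vertex set $W_m\cup\{v_L: L\in\mathcal L^{(m)},v\in L\}$ (new formal symbols $v_L$) and edges $E_m\cup\{\{v_L,v\}:L\in\mathcal L^{(m)},v\in L\}$; $\widetilde L=\{v_L:v\in L\}$. A flow basis is a collection $\mathcal F^{(m)}$ of flows in $\widetilde G_m$ with: (FB1) each member is a unit flow from $\widetilde L_1$ to $\widetilde L_2$ for some distinct $L_1,L_2\in\mathcal L^{(m)}$, and for each ordered pair of distinct $L_1,L_2$ there is exactly one such member, denoted $\mathcal F_{[L_1\to L_2]}$; (FB2) if $L\notin\{L_1,L_2\}$ then $\mathcal F_{[L_1\to L_2]}(v_L,v)=0$ for all $v\in L$; (FB3) if $L\notin\{L_1,L_2\}$ then for all $v\in L$, $\mathcal F_{[L\to L_1]}(v_L,v)=\mathcal F_{[L\to L_2]}(v_L,v)$ and $\mathcal F_{[L_1\to L]}(v,v_L)=\mathcal F_{[L_2\to L]}(v,v_L)$; (FB4) if $L_1=I^{(m)}_{t,\star}$ and $L_2=I^{(m)}_{t,-\star}$ then for all $v\in L_1$, $\mathcal F_{[L_1\to L_2]}(v_{L_1},v)=\mathcal F_{[L_1\to L_2]}(\eta_t(v),\eta_t(v)_{L_2})$ and $\mathcal F_{[L_1\to L_2]}(v_{L_1},v)=\mathcal F_{[L_2\to L_1]}(v,v_{L_1})$. Here $\eta_t$ is the given flipping symmetry of type $t$. $\mathcal E_q(\mathcal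 F^{(m)}):=\max\{\mathcal E_q(F):F\in\mathcal F^{(m)}\}$. *)

theory Defs
  imports Complex_Main
begin

section \<open>Graphs and flows\<close>

text \<open>A graph is given by a vertex set V and an oriented edge set Eg with
  Eg \<subseteq> V \<times> V and at most one orientation of each pair.
  Flows are functions on all pairs of vertices.\<close>

definition adj :: "('v \<times> 'v) set \<Rightarrow> 'v \<Rightarrow> 'v \<Rightarrow> bool" where
  "adj Eg x y \<longleftrightarrow> (x, y) \<in> Eg \<or> (y, x) \<in> Eg"

definition divg :: "'v set \<Rightarrow> ('v \<times> 'v) set \<Rightarrow> ('v \<Rightarrow> 'v \<Rightarrow> real) \<Rightarrow> 'v \<Rightarrow> real" where
  "divg V Eg F x = (\<Sum>y\<in>{y\<in>V. adj Eg x y}. F x y)"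

definition is_flow :: "'v set \<Rightarrow> ('v \<times> 'v) set \<Rightarrow> 'v set \<Rightarrow> 'v set \<Rightarrow> ('v \<Rightarrow> 'v \<Rightarrow> real) \<Rightarrow> bool" where
  "is_flow V Eg A B F \<longleftrightarrow>
     A \<subseteq> V \<and> B \<subseteq> V \<and> A \<noteq> {} \<and> B \<noteq> {} \<and> A \<inter> B = {} \<and>
     (\<forall>x y. F x y = - F y x) \<and>
     (\<forall>x y. \<not> adj Eg x y \<longrightarrow> F x y = 0) \<and>
     (\<forall>x \<in> V - (A \<union> B). divg V Eg F x = 0)"

definition unit_flow :: "'v set \<Rightarrow> ('v \<times> 'v) set \<Rightarrow> 'v set \<Rightarrow> 'v set \<Rightarrow> ('v \<Rightarrow> 'v \<Rightarrow> real) \<Rightarrow> bool" where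
  "unit_flow V Eg A B F \<longleftrightarrow> is_flow V Eg A B F \<and> (\<Sum>x\<in>A. divg V Eg F x) = 1"

text \<open>q-energy; each (oriented) edge counted once.\<close>
definition energy :: "('v \<times> 'v) set \<Rightarrow> real \<Rightarrow> ('v \<Rightarrow> 'v \<Rightarrow> real) \<Rightarrow> real" where
  "energy Eg q F = (\<Sum>e\<in>Eg. \<bar>F (fst e) (snd e)\<bar> powr q)"

definition min_energy :: "'v set \<Rightarrow> ('v \<times> 'v) set \<Rightarrow> real \<Rightarrow> 'v set \<Rightarrow> 'v set \<Rightarrow> real" where
  "min_energy V Eg q A B = Inf {energy Eg q F | F. unit_flow V Eg A B F}"

section \<open>Iterated graph systems\<close>

text \<open>An IGS is given by (S, E, tp, T, I): symbols, oriented edges, typing, type set, gluing rules.\<close>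

definition IGS :: "'a set \<Rightarrow> ('a \<times> 'a) set \<Rightarrow> ('a \<times> 'a \<Rightarrow> 't) \<Rightarrow> 't set \<Rightarrow> ('t \<Rightarrow> ('a \<times> 'a) set) \<Rightarrow> bool" where
  "IGS S E tp T I \<longleftrightarrow>
     finite S \<and> S \<noteq> {} \<and> E \<subseteq> S \<times> S \<and> (\<forall>x y. (x, y) \<in> E \<longrightarrow> (y, x) \<notin> E) \<and>
     (\<forall>x\<in>S. \<forall>y\<in>S. (x, y) \<in> (E \<union> E\<inverse>)\<^sup>*) \<and>
     finite T \<and> tp ` E = T \<and> (\<forall>t\<in>T. I t \<noteq> {} \<and> I t \<subseteq> S \<times> S)"

definition graph_map :: "'a set \<Rightarrow> ('a \<times> 'a) set \<Rightarrow> 'b set \<Rightarrow> ('b \<times> 'b) set \<Rightarrow> ('a \<Rightarrow> 'b) \<Rightarrow> bool" where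
  "graph_map S E S' E' \<phi> \<longleftrightarrow> \<phi> ` S \<subseteq> S' \<and>
     (\<forall>(w, v) \<in> E. \<phi> w = \<phi> v \<or> adj E' (\<phi> w) (\<phi> v))"

definition IGS_map ::
  "'a set \<Rightarrow> ('a \<times> 'a) set \<Rightarrow> ('a \<times> 'a \<Rightarrow> 't) \<Rightarrow> ('t \<Rightarrow> ('a \<times> 'a) set) \<Rightarrow>
   'b set \<Rightarrow> ('b \<times> 'b) set \<Rightarrow> ('b \<times> 'b \<Rightarrow> 's) \<Rightarrow> ('s \<Rightarrow> ('b \<times> 'b) set) \<Rightarrow> ('a \<Rightarrow> 'b) \<Rightarrow> bool" where
  "IGS_map S E tp I S' E' tp' I' \<phi> \<longleftrightarrow> graph_map S E S' E' \<phi> \<and>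
     (\<forall>(w1, v1) \<in> E. \<phi> w1 = \<phi> v1 \<longrightarrow>
        (\<forall>(w2, v2) \<in> I (tp (w1, v1)). \<phi> w2 = \<phi> v2)) \<and>
     (\<forall>(w1, v1) \<in> E. (\<phi> w1, \<phi> v1) \<in> E' \<longrightarrow>
        (\<forall>(w2, v2) \<in> I (tp (w1, v1)). (\<phi> w2, \<phi> v2) \<in> I' (tp' (\<phi> w1, \<phi> v1)))) \<and>
     (\<forall>(w1, v1) \<in> E. (\<phi> v1, \<phi> w1) \<in> E' \<longrightarrow>
        (\<forall>(w2, v2) \<in> I (tp (w1, v1)). (\<phi> v2, \<phi> w2) \<in> I' (tp' (\<phi> v1, \<phi> w1))))"

definition IGS_iso ::
  "'a set \<Rightarrow> ('a \<times> 'a) set \<Rightarrow> ('a \<times> 'a \<Rightarrow> 't) \<Rightarrow> ('t \<Rightarrow> ('a \<times> 'a) set) \<Rightarrow>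
   'b set \<Rightarrow> ('b \<times> 'b) set \<Rightarrow> ('b \<times> 'b \<Rightarrow> 's) \<Rightarrow> ('s \<Rightarrow> ('b \<times> 'b) set) \<Rightarrow> ('a \<Rightarrow> 'b) \<Rightarrow> bool" where
  "IGS_iso S E tp I S' E' tp' I' \<phi> \<longleftrightarrow>
     bij_betw \<phi> S S' \<and> (\<forall>w\<in>S. \<forall>v\<in>S. adj E w v \<longleftrightarrow> adj E' (\<phi> w) (\<phi> v)) \<and>
     IGS_map S E tp I S' E' tp' I' \<phi> \<and>
     IGS_map S' E' tp' I' S E tp I (inv_into S \<phi>)"

text \<open>Sub-system: same type set, typing agrees, inclusion is a mapping of IGS.\<close>
definition sub_system ::
  "'a set \<Rightarrow> ('a \<times> 'a) set \<Rightarrow> ('a \<times> 'a \<Rightarrow> 't) \<Rightarrow> 't set \<Rightarrow> ('t \<Rightarrow> ('a \<times> 'a) set) \<Rightarrow>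
   'a set \<Rightarrow> ('a \<times> 'a) set \<Rightarrow> ('a \<times> 'a \<Rightarrow> 't) \<Rightarrow> 't set \<Rightarrow> ('t \<Rightarrow> ('a \<times> 'a) set) \<Rightarrow> bool" where
  "sub_system S E tp T I S' E' tp' T' I' \<longleftrightarrow>
     IGS S E tp T I \<and> IGS S' E' tp' T' I' \<and> S \<subseteq> S' \<and> T = T' \<and>
     (\<forall>e\<in>E. tp e = tp' e) \<and> IGS_map S E tp I S' E' tp' I' id"

section \<open>Replacement graphs\<close>

text \<open>Words of length m over X (letters w_1 ... w_m, w_1 first in the list).\<close>
definition words :: "'a set \<Rightarrow> nat \<Rightarrow> 'a list set" where
  "words X m = {w. length w = m \<and> set w \<subseteq> X}"

text \<open>Typed edges of G_m: pairs (edge, type).\<close>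
fun rep_typed ::
  "'a set \<Rightarrow> ('a \<times> 'a) set \<Rightarrow> ('a \<times> 'a \<Rightarrow> 't) \<Rightarrow> ('t \<Rightarrow> ('a \<times> 'a) set) \<Rightarrow> nat \<Rightarrow>
   (('a list \<times> 'a list) \<times> 't) set" where
  "rep_typed S E tp I 0 = {}"
| "rep_typed S E tp I (Suc m) =
     (if m = 0 then {(([a], [b]), tp (a, b)) | a b. (a, b) \<in> E}
      else {((u @ [a], u @ [b]), tp (a, b)) | u a b. u \<in> words S m \<and> (a, b) \<in> E}
         \<union> {((u @ [a], u' @ [b]), t) | u u' a b t. ((u, u'), t) \<in> rep_typed S E tp I m \<and> (a, b) \<in> I t})"

definition rep_edges ::
  "'a set \<Rightarrow> ('a \<times> 'a) set \<Rightarrow> ('a \<times> 'a \<Rightarrow> 't) \<Rightarrow> ('t \<Rightarrow> ('a \<times> 'a) set) \<Rightarrow> nat \<Rightarrow> ('a list \<times> 'a list) set" where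
  "rep_edges S E tp I m = fst ` rep_typed S E tp I m"

definition Iplus :: "('t \<Rightarrow> ('a \<times> 'a) set) \<Rightarrow> 't \<Rightarrow> 'a set" where
  "Iplus I t = fst ` I t"

definition Iminus :: "('t \<Rightarrow> ('a \<times> 'a) set) \<Rightarrow> 't \<Rightarrow> 'a set" where
  "Iminus I t = snd ` I t"

text \<open>I_{t,+}^(m) (b = True) and I_{t,-}^(m) (b = False).\<close>
definition Iside :: "('t \<Rightarrow> ('a \<times> 'a) set) \<Rightarrow> bool \<Rightarrow> 't \<Rightarrow> nat \<Rightarrow> 'a list set" where
  "Iside I b t m = words (if b then Iplus I t else Iminus I t) m"

definition Lfam :: "'t set \<Rightarrow> ('t \<Rightarrow> ('a \<times> 'a) set) \<Rightarrow> nat \<Rightarrow> 'a list set set" where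
  "Lfam T I m = {Iside I b t m | b t. t \<in> T}"

section \<open>The augmented graph and flow bases\<close>

type_synonym 'a tvert = "'a list + ('a list set \<times> 'a list)"

text \<open>Inl w is the vertex w of W_m; Inr (L, v) is the formal vertex v_L.\<close>
definition tilde_V :: "'a set \<Rightarrow> 't set \<Rightarrow> ('t \<Rightarrow> ('a \<times> 'a) set) \<Rightarrow> nat \<Rightarrow> 'a tvert set" where
  "tilde_V S T I m = Inl ` words S m \<union> {Inr (L, v) | L v. L \<in> Lfam T I m \<and> v \<in> L}"

definition tilde_E ::
  "'a set \<Rightarrow> ('a \<times> 'a) set \<Rightarrow> ('a \<times> 'a \<Rightarrow> 't) \<Rightarrow> 't set \<Rightarrow> ('t \<Rightarrow> ('a \<times> 'a) set) \<Rightarrow> nat \<Rightarrow>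
   ('a tvert \<times> 'a tvert) set" where
  "tilde_E S E tp T I m = (\<lambda>(x, y). (Inl x, Inl y)) ` rep_edges S E tp I m
      \<union> {(Inr (L, v), Inl v) | L v. L \<in> Lfam T I m \<and> v \<in> L}"

definition tildeL :: "'a list set \<Rightarrow> 'a tvert set" where
  "tildeL L = {Inr (L, v) | v. v \<in> L}"

text \<open>A flow basis, indexed by ordered pairs (L1, L2) of distinct members of the family:
  Fb L1 L2 is the flow F_[L1 -> L2].  eta t is the flipping symmetry of type t.\<close>
definition flow_basis ::
  "'a set \<Rightarrow> ('a \<times> 'a) set \<Rightarrow> ('a \<times> 'a \<Rightarrow> 't) \<Rightarrow> 't set \<Rightarrow> ('t \<Rightarrow> ('a \<times> 'a) set) \<Rightarrow>
   ('t \<Rightarrow> 'a \<Rightarrow> 'a) \<Rightarrow> nat \<Rightarrow>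
   ('a list set \<Rightarrow> 'a list set \<Rightarrow> 'a tvert \<Rightarrow> 'a tvert \<Rightarrow> real) \<Rightarrow> bool" where
  "flow_basis S E tp T I eta m Fb \<longleftrightarrow>
     (let Lf = Lfam T I m; V = tilde_V S T I m; Et = tilde_E S E tp T I m in
     (\<forall>L1\<in>Lf. \<forall>L2\<in>Lf. L1 \<noteq> L2 \<longrightarrow> unit_flow V Et (tildeL L1) (tildeL L2) (Fb L1 L2)) \<and>
     (\<forall>L1\<in>Lf. \<forall>L2\<in>Lf. \<forall>L\<in>Lf. L1 \<noteq> L2 \<and> L \<noteq> L1 \<and> L \<noteq> L2 \<longrightarrow>
        (\<forall>v\<in>L. Fb L1 L2 (Inr (L, v)) (Inl v) = 0)) \<and>
     (\<forall>L1\<in>Lf. \<forall>L2\<in>Lf. \<forall>L\<in>Lf. L \<noteq> L1 \<and> L \<noteq> L2 \<longrightarrow>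
        (\<forall>v\<in>L. Fb L L1 (Inr (L, v)) (Inl v) = Fb L L2 (Inr (L, v)) (Inl v) \<and>
                Fb L1 L (Inl v) (Inr (L, v)) = Fb L2 L (Inl v) (Inr (L, v)))) \<and>
     (\<forall>t\<in>T. \<forall>b. Iside I b t m \<noteq> Iside I (\<not> b) t m \<longrightarrow>
        (let L1 = Iside I b t m; L2 = Iside I (\<not> b) t m in
         \<forall>v\<in>L1. Fb L1 L2 (Inr (L1, v)) (Inl v) =
                   Fb L1 L2 (Inl (map (eta t) v)) (Inr (L2, map (eta t) v)) \<and>
                 Fb L1 L2 (Inr (L1, v)) (Inl v) = Fb L2 L1 (Inl v) (Inr (L1, v)))))"

definition fb_energy ::
  "'a set \<Rightarrow> ('a \<times> 'a) set \<Rightarrow> ('a \<times> 'a \<Rightarrow> 't) \<Rightarrow> 't set \<Rightarrow> ('t \<Rightarrow> ('a \<times> 'a) set) \<Rightarrow> nat \<Rightarrow> real \<Rightarrow>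
   ('a list set \<Rightarrow> 'a list set \<Rightarrow> 'a tvert \<Rightarrow> 'a tvert \<Rightarrow> real) \<Rightarrow> real" where
  "fb_energy S E tp T I m q Fb =
     Max {energy (tilde_E S E tp T I m) q (Fb L1 L2) | L1 L2.
            L1 \<in> Lfam T I m \<and> L2 \<in> Lfam T I m \<and> L1 \<noteq> L2}"

section \<open>Cubical IGS\<close>

text \<open>Symbols: (c, h) with c a list of d coordinates (coordinate j stored at index j, 0-based,
  corresponding to the paper's c_{j+1}) in {1..L}, and h the sheet in {1..s}.
  Types t_1..t_d are represented by 0..d-1.\<close>
type_synonym sym = "nat list \<times> nat"

definition cube_syms :: "nat \<Rightarrow> nat \<Rightarrow> nat \<Rightarrow> sym set" where
  "cube_syms d L s = {(c, h). length c = d \<and> (\<forall>i<d. 1 \<le> c ! i \<and> c ! i \<le> L) \<and> 1 \<le> h \<and> h \<le> s}"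

definition cube_edge :: "nat \<Rightarrow> nat \<Rightarrow> nat \<Rightarrow> nat \<Rightarrow> sym \<Rightarrow> sym \<Rightarrow> bool" where
  "cube_edge d L s j w v \<longleftrightarrow> w \<in> cube_syms d L s \<and> v \<in> cube_syms d L s \<and> j < d \<and>
     (\<forall>i<d. i \<noteq> j \<longrightarrow> fst v ! i = fst w ! i) \<and> fst v ! j = fst w ! j + 1"

definition cube_E :: "nat \<Rightarrow> nat \<Rightarrow> nat \<Rightarrow> (sym \<times> sym) set" where
  "cube_E d L s = {(w, v). \<exists>j. cube_edge d L s j w v}"

text \<open>Type of an edge: the (unique) coordinate in which its endpoints differ.\<close>
definition cube_tp :: "nat \<Rightarrow> sym \<times> sym \<Rightarrow> nat" where
  "cube_tp d e = (LEAST j. j < d \<and> fst (fst e) ! j \<noteq> fst (snd e) ! j)"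

definition cube_I :: "nat \<Rightarrow> nat \<Rightarrow> nat \<Rightarrow> nat \<Rightarrow> (sym \<times> sym) set" where
  "cube_I d L s j = {(w, v). w \<in> cube_syms d L s \<and> v \<in> cube_syms d L s \<and>
     (\<forall>i<d. i \<noteq> j \<longrightarrow> fst w ! i = fst v ! i) \<and> fst w ! j = L \<and> fst v ! j = 1 \<and> snd w = snd v}"

definition eta :: "nat \<Rightarrow> nat \<Rightarrow> sym \<Rightarrow> sym" where
  "eta L j x = ((fst x)[j := L + 1 - fst x ! j], snd x)"

definition alpha_plus :: "nat \<Rightarrow> nat \<Rightarrow> sym \<Rightarrow> sym" where
  "alpha_plus j k x = ((fst x)[j := fst x ! k, k := fst x ! j], snd x)"

definition alpha_minus :: "nat \<Rightarrow> nat \<Rightarrow> nat \<Rightarrow> sym \<Rightarrow> sym" where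
  "alpha_minus L j k x = ((fst x)[k := L + 1 - fst x ! j, j := L + 1 - fst x ! k], snd x)"

definition cube_G :: "nat \<Rightarrow> nat \<Rightarrow> (sym \<Rightarrow> sym) set" where
  "cube_G d L = {eta L j | j. j < d}
     \<union> {alpha_plus j k | j k. j < d \<and> k < d \<and> j \<noteq> k}
     \<union> {alpha_minus L j k | j k. j < d \<and> k < d \<and> j \<noteq> k}"

text \<open>Condition (*_j).\<close>
definition star_cond :: "nat \<Rightarrow> nat \<Rightarrow> nat \<Rightarrow> nat \<Rightarrow> sym \<Rightarrow> bool" where
  "star_cond d L s j w \<longleftrightarrow> w \<in> cube_syms d L s \<and>
     (\<forall>i<d. i \<noteq> j \<longrightarrow> fst w ! i \<in> {1, L}) \<and> snd w = 1"

definition cubical_IGS ::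
  "nat \<Rightarrow> nat \<Rightarrow> nat \<Rightarrow> sym set \<Rightarrow> (sym \<times> sym) set \<Rightarrow> (nat \<Rightarrow> (sym \<times> sym) set) \<Rightarrow> bool" where
  "cubical_IGS d L s S E I \<longleftrightarrow>
     sub_system S E (cube_tp d) {..<d} I
                (cube_syms d L s) (cube_E d L s) (cube_tp d) {..<d} (cube_I d L s) \<and>
     (\<forall>j<d. \<forall>w. star_cond d L s j w \<longrightarrow> w \<in> S) \<and>
     (\<forall>j<d. \<forall>w v. star_cond d L s j w \<and> star_cond d L s j v \<and>
        (\<forall>i<d. i \<noteq> j \<longrightarrow> fst w ! i = fst v ! i) \<and> snd w = snd v \<and>
        fst v ! j = fst w ! j + 1 \<longrightarrow> (w, v) \<in> E) \<and>
     (\<forall>j<d. \<forall>w v. star_cond d L s j w \<and> star_cond d L s j v \<and>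
        (\<forall>i<d. i \<noteq> j \<longrightarrow> fst w ! i = fst v ! i) \<and> snd w = snd v \<and>
        fst w ! j = L \<and> fst v ! j = 1 \<longrightarrow> (w, v) \<in> I j) \<and>
     (\<forall>\<alpha>\<in>cube_G d L. \<alpha> ` S = S \<and>
        IGS_iso S E (cube_tp d) I S E (cube_tp d) I \<alpha>)"

end

theory Submission
  imports Defs
begin

text \<open>Start from a unit flow from \<open>I\<^bsub>0,-\<^esub>\<close> to \<open>I\<^bsub>0,+\<^esub>\<close> whose energy is at most twice the infimum and
  antisymmetrise it under the flip \<open>\<eta>\<^sub>0\<close>; its divergence becomes \<open>f - f \<circ> \<eta>\<^sub>0\<close> with \<open>f\<close> supported on
  \<open>I\<^bsub>0,-\<^esub>\<close>. Folding the graph along the diagonal hyperplane \<open>c\<^sub>0 = c\<^sub>k\<close> is a graph map with fibers of at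
  most two elements, so pushing the flow forward costs at most a factor \<open>4\<^sup>q\<close> and yields a flow from
  \<open>I\<^bsub>0,-\<^esub>\<close> to \<open>I\<^bsub>k,+\<^esub>\<close>; the swap of the coordinates \<open>0\<close> and \<open>k\<close> yields one from \<open>I\<^bsub>k,-\<^esub>\<close> to \<open>I\<^bsub>k,+\<^esub>\<close>. This
  joins each face to the root face \<open>I\<^bsub>0,-\<^esub>\<close> with boundary values depending on the face only, and
  the members of the basis are differences of these flows, whose values at the root cancel. The
  edges to the formal vertices carry the divergence, which is controlled by the energy because the
  degrees in the replacement graphs are bounded uniformly in \<open>m\<close>.\<close>

section \<open>Flows with prescribed divergence\<close>

text \<open>The part of \<open>is_flow\<close> that does not mention source and sink; the divergence
  is then prescribed separately, so that flows with different boundary behaviour can be combined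
  linearly.\<close>

definition edge_flow :: "('v \<times> 'v) set \<Rightarrow> ('v \<Rightarrow> 'v \<Rightarrow> real) \<Rightarrow> bool" where
  "edge_flow Eg F \<longleftrightarrow> (\<forall>x y. F x y = - F y x) \<and> (\<forall>x y. \<not> adj Eg x y \<longrightarrow> F x y = 0)"

text \<open>For an edge flow on a finite vertex set the summands off the edges vanish, so this is
  the divergence.\<close>

definition outflow :: "'v set \<Rightarrow> ('v \<Rightarrow> 'v \<Rightarrow> real) \<Rightarrow> 'v \<Rightarrow> real" where
  "outflow V F x = (\<Sum>y\<in>V. F x y)"

text \<open>Every edge is counted in both orientations, so for flows this is twice \<open>energy\<close>.\<close>
definition pair_energy :: "'v set \<Rightarrow> real \<Rightarrow> ('v \<Rightarrow> 'v \<Rightarrow> real) \<Rightarrow> real" where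
  "pair_energy V q F = (\<Sum>x\<in>V. \<Sum>y\<in>V. \<bar>F x y\<bar> powr q)"

definition fiber :: "'v set \<Rightarrow> ('v \<Rightarrow> 'w) \<Rightarrow> 'w \<Rightarrow> 'v set" where
  "fiber V \<pi> x = {x' \<in> V. \<pi> x' = x}"

text \<open>The push-forward along \<open>\<pi>\<close>: all flow between two fibers is collected on
  the pair of their images.\<close>

definition push_flow :: "'v set \<Rightarrow> ('v \<Rightarrow> 'v) \<Rightarrow> ('v \<Rightarrow> 'v \<Rightarrow> real) \<Rightarrow> 'v \<Rightarrow> 'v \<Rightarrow> real" where
  "push_flow V \<pi> F x y = (\<Sum>x'\<in>fiber V \<pi> x. \<Sum>y'\<in>fiber V \<pi> y. F x' y')"

lemma adj_sym: "adj Eg x y \<longleftrightarrow> adj Eg y x"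
  by (auto simp: adj_def)

lemma edge_flow_antisym: "edge_flow Eg F \<Longrightarrow> F x y = - F y x"
  unfolding edge_flow_def by blast

lemma edge_flow_zero: "edge_flow Eg F \<Longrightarrow> \<not> adj Eg x y \<Longrightarrow> F x y = 0"
  unfolding edge_flow_def by blast

lemma edge_flow_diff:
  assumes "edge_flow Eg F" "edge_flow Eg G"
  shows "edge_flow Eg (\<lambda>x y. F x y - G x y)"
  unfolding edge_flow_def
proof (intro conjI allI impI)
  fix x y
  show "F x y - G x y = - (F y x - G y x)"
    using edge_flow_antisym[OF assms(1), of x y] edge_flow_antisym[OF assms(2), of x y] by simp
  show "F x y - G x y = 0" if "\<not> adj Eg x y"
    using edge_flow_zero[OF assms(1) that] edge_flow_zero[OF assms(2) that] by simp
qed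

lemma edge_flow_scale:
  assumes "edge_flow Eg F"
  shows "edge_flow Eg (\<lambda>x y. c * F x y)"
  unfolding edge_flow_def
proof (intro conjI allI impI)
  fix x y
  show "c * F x y = - (c * F y x)"
    using edge_flow_antisym[OF assms, of x y] by simp
  show "c * F x y = 0" if "\<not> adj Eg x y"
    using edge_flow_zero[OF assms that] by simp
qed

lemma divg_eq_outflow:
  assumes "finite V" "edge_flow Eg F"
  shows "divg V Eg F x = outflow V F x"
  unfolding divg_def outflow_def
  using assms by (intro sum.mono_neutral_left) (auto intro: edge_flow_zero)

lemma outflow_diff: "outflow V (\<lambda>x y. F x y - G x y) x = outflow V F x - outflow V G x"
  by (simp add: outflow_def sum_subtractf)

lemma outflow_scale: "outflow V (\<lambda>x y. c * F x y) x = c * outflow V F x"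
  by (simp add: outflow_def sum_distrib_left)

lemma sum_sum_antisym_eq_0:
  fixes F :: "'v \<Rightarrow> 'v \<Rightarrow> real"
  assumes "\<And>x y. F x y = - F y x"
  shows "(\<Sum>x\<in>A. \<Sum>y\<in>A. F x y) = 0"
proof -
  have "(\<Sum>x\<in>A. \<Sum>y\<in>A. F x y) = (\<Sum>x\<in>A. \<Sum>y\<in>A. - F y x)"
    using assms by (intro sum.cong refl) metis
  also have "\<dots> = - (\<Sum>y\<in>A. \<Sum>x\<in>A. F y x)"
    by (subst sum.swap) (simp add: sum_negf)
  finally show ?thesis by simp
qed

section \<open>Energy estimates for sums, differences and multiples of flows\<close>

lemma pair_energy_nonneg: "pair_energy V q F \<ge> 0"
  unfolding pair_energy_def by (intro sum_nonneg) auto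

text \<open>The sum is at most \<open>N\<close> times its largest term in modulus, and the
  \<open>q\<close>-th power of that term is one of the summands on the right.\<close>

lemma abs_sum_powr_le:
  fixes a :: "'b \<Rightarrow> real"
  assumes "finite A" "card A \<le> N" "q > 0"
  shows "\<bar>\<Sum>i\<in>A. a i\<bar> powr q \<le> real N powr q * (\<Sum>i\<in>A. \<bar>a i\<bar> powr q)"
proof (cases "A = {}")
  case True
  then show ?thesis by simp
next
  case False
  define M where "M = Max ((\<lambda>i. \<bar>a i\<bar>) ` A)"
  have "M \<in> (\<lambda>i. \<bar>a i\<bar>) ` A"
    unfolding M_def using assms False by (intro Max_in) auto
  then obtain i0 where i0: "i0 \<in> A" "M = \<bar>a i0\<bar>" by blast
  have le: "\<bar>a i\<bar> \<le> M" if "i \<in> A" for i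
    unfolding M_def using that assms by auto
  have "\<bar>\<Sum>i\<in>A. a i\<bar> \<le> (\<Sum>i\<in>A. \<bar>a i\<bar>)" by (rule sum_abs)
  also have "\<dots> \<le> real (card A) * M" using le by (rule sum_bounded_above)
  also have "\<dots> \<le> real N * M"
    using assms i0 by (intro mult_right_mono) auto
  finally have "\<bar>\<Sum>i\<in>A. a i\<bar> powr q \<le> (real N * M) powr q"
    using assms by (intro powr_mono2) auto
  also have "\<dots> = real N powr q * M powr q"
    using i0 by (simp add: powr_mult)
  also have "M powr q \<le> (\<Sum>i\<in>A. \<bar>a i\<bar> powr q)"
    using assms i0 by (auto intro!: member_le_sum[of i0 A "\<lambda>i. \<bar>a i\<bar> powr q"])
  finally show ?thesis by (simp add: mult_left_mono)
qed

lemma abs_diff_powr_le: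
  fixes a b :: real
  assumes "q > 0"
  shows "\<bar>a - b\<bar> powr q \<le> 2 powr q * (\<bar>a\<bar> powr q + \<bar>b\<bar> powr q)"
  using abs_sum_powr_le[of "{True, False}" 2 q "\<lambda>i. if i then a else - b"] assms by simp

lemma pair_energy_diff_le:
  assumes "q > 0"
  shows "pair_energy V q (\<lambda>x y. F x y - G x y) \<le> 2 powr q * (pair_energy V q F + pair_energy V q G)"
proof -
  have "pair_energy V q (\<lambda>x y. F x y - G x y)
      \<le> (\<Sum>x\<in>V. \<Sum>y\<in>V. 2 powr q * (\<bar>F x y\<bar> powr q + \<bar>G x y\<bar> powr q))"
    unfolding pair_energy_def by (intro sum_mono abs_diff_powr_le assms)
  also have "\<dots> = 2 powr q * (pair_energy V q F + pair_energy V q G)"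
    unfolding pair_energy_def by (simp add: sum.distrib flip: sum_distrib_left)
  finally show ?thesis .
qed

lemma pair_energy_scale: "pair_energy V q (\<lambda>x y. c * F x y) = \<bar>c\<bar> powr q * pair_energy V q F"
  unfolding pair_energy_def
  by (simp add: abs_mult powr_mult sum_distrib_left)

lemma energy_le_pair_energy:
  assumes "finite V" "Eg \<subseteq> V \<times> V"
  shows "energy Eg q F \<le> pair_energy V q F"
proof -
  have "energy Eg q F \<le> (\<Sum>e\<in>V \<times> V. \<bar>F (fst e) (snd e)\<bar> powr q)"
    unfolding energy_def using assms by (intro sum_mono2) auto
  also have "\<dots> = pair_energy V q F"
    unfolding pair_energy_def by (simp add: sum.cartesian_product case_prod_beta)
  finally show ?thesis .
qed

text \<open>The flow vanishes off \<open>Eg \<union> Eg\<inverse>\<close>, and by antisymmetry both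
  orientations carry the same energy.\<close>

lemma pair_energy_le_energy:
  assumes "finite V" "Eg \<subseteq> V \<times> V" "edge_flow Eg F"
  shows "pair_energy V q F \<le> 2 * energy Eg q F"
proof -
  let ?g = "\<lambda>e. \<bar>F (fst e) (snd e)\<bar> powr q"
  have fin: "finite Eg" using assms finite_subset by blast
  have "pair_energy V q F = sum ?g (V \<times> V)"
    unfolding pair_energy_def by (simp add: sum.cartesian_product case_prod_beta)
  also have "\<dots> = sum ?g (Eg \<union> Eg\<inverse>)"
  proof (rule sum.mono_neutral_right)
    show "\<forall>e\<in>V \<times> V - (Eg \<union> Eg\<inverse>). ?g e = 0"
      by (auto simp: adj_def intro!: edge_flow_zero[OF assms(3)])
  qed (use assms in auto)
  also have "\<dots> \<le> sum ?g Eg + sum ?g (Eg\<inverse>)"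
    using sum.union_inter[of Eg "Eg\<inverse>" ?g] fin sum_nonneg[of "Eg \<inter> Eg\<inverse>" ?g] by fastforce
  also have "sum ?g (Eg\<inverse>) = sum ?g Eg"
  proof (rule sum.reindex_bij_witness[where i = prod.swap and j = prod.swap])
    fix e assume "e \<in> Eg\<inverse>"
    show "?g (prod.swap e) = ?g e"
      using edge_flow_antisym[OF assms(3), of "fst e" "snd e"] by simp
  qed auto
  finally show ?thesis by (simp add: energy_def)
qed

section \<open>Push-forward of flows along vertex maps\<close>

lemma sum_fibers:
  fixes g :: "'v \<Rightarrow> real"
  assumes "finite V" "\<pi> ` V \<subseteq> V'" "finite V'"
  shows "(\<Sum>x\<in>V'. \<Sum>x'\<in>fiber V \<pi> x. g x') = (\<Sum>x\<in>V. g x)"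
  unfolding fiber_def using assms sum.group by blast

text \<open>Collapsed edges are harmless: their flow lands on the diagonal, where the double sum
  over one fiber cancels by antisymmetry.\<close>

lemma edge_flow_push:
  assumes "edge_flow Eg F"
    and "\<And>x y. x \<in> V \<Longrightarrow> y \<in> V \<Longrightarrow> adj Eg x y \<Longrightarrow> \<pi> x = \<pi> y \<or> adj Eg (\<pi> x) (\<pi> y)"
  shows "edge_flow Eg (push_flow V \<pi> F)"
  unfolding edge_flow_def
proof (intro conjI allI impI)
  fix x y
  have "push_flow V \<pi> F x y = (\<Sum>x'\<in>fiber V \<pi> x. \<Sum>y'\<in>fiber V \<pi> y. - F y' x')"
    unfolding push_flow_def using edge_flow_antisym[OF assms(1)] by (intro sum.cong refl) metis
  also have "\<dots> = - push_flow V \<pi> F y x"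
    unfolding push_flow_def by (subst sum.swap) (simp add: sum_negf)
  finally show "push_flow V \<pi> F x y = - push_flow V \<pi> F y x" .
  assume nadj: "\<not> adj Eg x y"
  show "push_flow V \<pi> F x y = 0"
  proof (cases "x = y")
    case True
    then show ?thesis
      unfolding push_flow_def using sum_sum_antisym_eq_0 edge_flow_antisym[OF assms(1)] by metis
  next
    case False
    have "F x' y' = 0" if "x' \<in> fiber V \<pi> x" "y' \<in> fiber V \<pi> y" for x' y'
      using that nadj False assms(2)[of x' y'] edge_flow_zero[OF assms(1), of x' y']
      by (auto simp: fiber_def)
    then show ?thesis unfolding push_flow_def by simp
  qed
qed

text \<open>The fibers partition \<open>V\<close>, so summing over all targets restores the full
  divergence of each preimage.\<close>

lemma outflow_push:
  assumes "finite V" "\<pi> ` V \<subseteq> V"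
  shows "outflow V (push_flow V \<pi> F) x = (\<Sum>x'\<in>fiber V \<pi> x. outflow V F x')"
proof -
  have "outflow V (push_flow V \<pi> F) x
      = (\<Sum>x'\<in>fiber V \<pi> x. \<Sum>y\<in>V. \<Sum>y'\<in>fiber V \<pi> y. F x' y')"
    unfolding outflow_def push_flow_def by (rule sum.swap)
  then show ?thesis
    unfolding outflow_def using sum_fibers[OF assms(1,2,1)] by simp
qed

text \<open>A pair of vertices has at most \<open>2 * 2 = 4\<close> pairs of preimages, and every
  pair upstairs is counted once.\<close>

lemma pair_energy_push:
  assumes "finite V" "\<pi> ` V \<subseteq> V" "q > 0" "\<And>x. x \<in> V \<Longrightarrow> card (fiber V \<pi> x) \<le> 2"
  shows "pair_energy V q (push_flow V \<pi> F) \<le> 4 powr q * pair_energy V q F"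
proof -
  have fin: "finite (fiber V \<pi> x)" for x using assms by (simp add: fiber_def)
  have "\<bar>push_flow V \<pi> F x y\<bar> powr q
      \<le> 4 powr q * (\<Sum>x'\<in>fiber V \<pi> x. \<Sum>y'\<in>fiber V \<pi> y. \<bar>F x' y'\<bar> powr q)"
    if "x \<in> V" "y \<in> V" for x y
  proof -
    have "card (fiber V \<pi> x \<times> fiber V \<pi> y) \<le> 2 * 2"
      unfolding card_cartesian_product using assms(4) that by (intro mult_le_mono) auto
    then show ?thesis
      using abs_sum_powr_le[of "fiber V \<pi> x \<times> fiber V \<pi> y" 4 q "\<lambda>(x', y'). F x' y'"] assms fin
      by (simp add: push_flow_def sum.cartesian_product case_prod_beta)
  qed
  then have "pair_energy V q (push_flow V \<pi> F)
      \<le> (\<Sum>x\<in>V. \<Sum>y\<in>V. 4 powr q * (\<Sum>x'\<in>fiber V \<pi> x. \<Sum>y'\<in>fiber V \<pi> y. \<bar>F x' y'\<bar> powr q))"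
    unfolding pair_energy_def by (intro sum_mono)
  also have "\<dots> = 4 powr q *
      (\<Sum>x\<in>V. \<Sum>x'\<in>fiber V \<pi> x. \<Sum>y\<in>V. \<Sum>y'\<in>fiber V \<pi> y. \<bar>F x' y'\<bar> powr q)"
    by (subst sum.swap[of _ V "fiber V \<pi> _"]) (simp add: sum_distrib_left)
  also have "\<dots> = 4 powr q * pair_energy V q F"
    unfolding pair_energy_def by (simp add: sum_fibers[OF assms(1,2,1)])
  finally show ?thesis .
qed

lemma fiber_involution:
  assumes "A ` V \<subseteq> V" "\<And>x. x \<in> V \<Longrightarrow> A (A x) = x" "x \<in> V"
  shows "fiber V A x = {A x}"
  using assms unfolding fiber_def by force

text \<open>On the support of \<open>g\<close> the map \<open>\<pi>\<close> acts as the involution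
  \<open>\<rho>\<close>, so only the preimage \<open>\<rho> x\<close> can contribute.\<close>

lemma sum_fiber_supported:
  fixes g :: "'v \<Rightarrow> real"
  assumes "finite V" "x \<in> V" "\<rho> ` V \<subseteq> V" "\<And>x. x \<in> V \<Longrightarrow> \<rho> (\<rho> x) = x"
    and "\<And>x'. x' \<in> V \<Longrightarrow> g x' \<noteq> 0 \<Longrightarrow> \<pi> x' = \<rho> x'"
  shows "(\<Sum>x'\<in>fiber V \<pi> x. g x') = g (\<rho> x)"
proof -
  have "(\<Sum>x'\<in>fiber V \<pi> x. g x') = (\<Sum>x'\<in>V. if \<pi> x' = x then g x' else 0)"
    unfolding fiber_def using assms(1) by (simp add: sum.inter_filter)
  also have "\<dots> = (\<Sum>x'\<in>V. if x' = \<rho> x then g x' else 0)"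
  proof (rule sum.cong)
    fix x' assume "x' \<in> V"
    then have "\<rho> x' = x \<longleftrightarrow> x' = \<rho> x" using assms(2,4) by metis
    then show "(if \<pi> x' = x then g x' else 0) = (if x' = \<rho> x then g x' else 0)"
      using assms(5)[OF \<open>x' \<in> V\<close>] by (cases "g x' = 0") auto
  qed simp
  also have "\<dots> = g (\<rho> x)" using assms by auto
  finally show ?thesis .
qed

section \<open>Path flows, unit flows and the minimal energy\<close>

lemma exists_path_flow:
  assumes "finite V" "(x, y) \<in> R\<^sup>*" "R \<subseteq> Eg" "Eg \<subseteq> V \<times> V"
  shows "\<exists>F. edge_flow Eg F \<and> (\<forall>z\<in>V. outflow V F z = of_bool (z = x) - of_bool (z = y))"
  using assms(2)
proof (induction rule: rtrancl_induct)
  case base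
  show ?case
    by (rule exI[of _ "\<lambda>_ _. 0"]) (simp add: edge_flow_def outflow_def)
next
  case (step y z)
  then obtain F where F: "edge_flow Eg F"
    "\<And>u. u \<in> V \<Longrightarrow> outflow V F u = of_bool (u = x) - of_bool (u = y)" by blast
  \<comment> \<open>A unit flow from \<open>z\<close> back to \<open>y\<close>; subtracting it
    extends the path flow by the step from \<open>y\<close> to \<open>z\<close>.\<close>
  define G :: "'a \<Rightarrow> 'a \<Rightarrow> real" where
    "G u v = of_bool (u = z) * of_bool (v = y) - of_bool (u = y) * of_bool (v = z)" for u v
  have yz: "(y, z) \<in> Eg" "y \<in> V" "z \<in> V" using step assms by auto
  have "edge_flow Eg G" using yz by (auto simp: edge_flow_def G_def adj_def)
  moreover have "outflow V G u = of_bool (u = z) - of_bool (u = y)" for u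
  proof -
    have "(\<Sum>v\<in>V. of_bool (v = y)) = (1::real)" "(\<Sum>v\<in>V. of_bool (v = z)) = (1::real)"
      using yz assms(1) by (simp_all add: of_bool_def)
    then show ?thesis
      unfolding outflow_def G_def sum_subtractf by (simp flip: sum_distrib_left)
  qed
  ultimately show ?case
    using F edge_flow_diff[OF F(1), of G]
    by (intro exI[of _ "\<lambda>u v. F u v - G u v"]) (auto simp: outflow_diff)
qed

lemma unit_flow_iff:
  assumes "finite V"
  shows "unit_flow V Eg A B F \<longleftrightarrow> A \<subseteq> V \<and> B \<subseteq> V \<and> A \<noteq> {} \<and> B \<noteq> {} \<and> A \<inter> B = {} \<and>
    edge_flow Eg F \<and> (\<forall>x\<in>V - (A \<union> B). outflow V F x = 0) \<and> (\<Sum>x\<in>A. outflow V F x) = 1"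
proof -
  have "unit_flow V Eg A B F \<longleftrightarrow> A \<subseteq> V \<and> B \<subseteq> V \<and> A \<noteq> {} \<and> B \<noteq> {} \<and> A \<inter> B = {} \<and>
    edge_flow Eg F \<and> (\<forall>x\<in>V - (A \<union> B). divg V Eg F x = 0) \<and> (\<Sum>x\<in>A. divg V Eg F x) = 1"
    unfolding unit_flow_def is_flow_def edge_flow_def by blast
  then show ?thesis
    using divg_eq_outflow[OF assms, of Eg F] by (cases "edge_flow Eg F") simp_all
qed

lemma energy_nonneg: "energy Eg q F \<ge> 0"
  unfolding energy_def by (intro sum_nonneg) auto

lemma min_energy_le:
  assumes "unit_flow V Eg A B F"
  shows "min_energy V Eg q A B \<le> energy Eg q F"
  unfolding min_energy_def using assms energy_nonneg
  by (intro cInf_lower) (auto intro!: bdd_belowI[of _ 0])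

lemma le_min_energy:
  assumes "unit_flow V Eg A B F0" "\<And>F. unit_flow V Eg A B F \<Longrightarrow> c \<le> energy Eg q F"
  shows "c \<le> min_energy V Eg q A B"
  unfolding min_energy_def using assms by (intro cInf_greatest) auto

text \<open>A total flow of 1 out of \<open>A\<close> is spread over at most
  \<open>card (V \<times> V)\<close> pairs, which bounds the energies of all unit flows below by one
  positive number.\<close>

lemma min_energy_pos:
  assumes "finite V" "Eg \<subseteq> V \<times> V" "q > 0" "unit_flow V Eg A B F0"
  shows "min_energy V Eg q A B > 0"
proof -
  define K where "K = real (card (V \<times> V)) powr q"
  have "V \<noteq> {}" using assms(1,4) by (auto simp: unit_flow_iff)
  then have K: "K > 0" unfolding K_def using assms(1) by (simp add: card_gt_0_iff)
  have "1 / (2 * K) \<le> energy Eg q F" if F: "unit_flow V Eg A B F" for F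
  proof -
    have ef: "edge_flow Eg F" and AV: "A \<subseteq> V" using F assms(1) by (auto simp: unit_flow_iff)
    have "1 = \<bar>\<Sum>e\<in>A \<times> V. F (fst e) (snd e)\<bar> powr q"
      using F assms(1)
      by (simp add: unit_flow_iff outflow_def sum.cartesian_product case_prod_beta)
    also have "\<dots> \<le> K * (\<Sum>e\<in>A \<times> V. \<bar>F (fst e) (snd e)\<bar> powr q)"
      unfolding K_def using assms AV finite_subset[OF AV]
      by (intro abs_sum_powr_le card_mono) auto
    also have "\<dots> \<le> K * (\<Sum>e\<in>V \<times> V. \<bar>F (fst e) (snd e)\<bar> powr q)"
      using assms AV K by (intro mult_left_mono sum_mono2) auto
    also have "\<dots> = K * pair_energy V q F"
      by (simp add: pair_energy_def sum.cartesian_product case_prod_beta)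
    also have "\<dots> \<le> K * (2 * energy Eg q F)"
      using K pair_energy_le_energy[OF assms(1,2) ef] by (intro mult_left_mono) auto
    finally show ?thesis using K by (simp add: field_simps)
  qed
  then have "1 / (2 * K) \<le> min_energy V Eg q A B"
    using assms(4) by (intro le_min_energy) auto
  moreover have "1 / (2 * K) > 0" using K by simp
  ultimately show ?thesis by linarith
qed

section \<open>Replacement graphs\<close>

lemma words_0 [simp]: "words X 0 = {[]}"
  by (auto simp: words_def)

lemma words_snoc [simp]: "u @ [a] \<in> words X (Suc m) \<longleftrightarrow> u \<in> words X m \<and> a \<in> X"
  by (auto simp: words_def)

lemma finite_words: "finite X \<Longrightarrow> finite (words X m)"
  using finite_lists_length_eq[of X m] by (simp add: words_def conj_commute)

lemma map_in_words:
  assumes "u \<in> words X m" "\<And>a. a \<in> X \<Longrightarrow> \<phi> a \<in> Y"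
  shows "map \<phi> u \<in> words Y m"
  using assms by (auto simp: words_def)

lemma map_map_words:
  assumes "u \<in> words X m" "\<And>a. a \<in> X \<Longrightarrow> \<phi> (\<psi> a) = \<chi> a"
  shows "map \<phi> (map \<psi> u) = map \<chi> u"
  using assms by (auto simp: words_def)

text \<open>Merges the two clauses of the recursion: at \<open>m = 0\<close> the only prefix is the
  empty word and there are no edges to refine.\<close>

lemma rep_typed_Suc:
  "rep_typed S E tp I (Suc m) =
     {((u @ [a], u @ [b]), tp (a, b)) | u a b. u \<in> words S m \<and> (a, b) \<in> E}
   \<union> {((u @ [a], u' @ [b]), t) | u u' a b t. ((u, u'), t) \<in> rep_typed S E tp I m \<and> (a, b) \<in> I t}"
  by (cases m) auto

declare rep_typed.simps(2) [simp del]

text \<open>The \<open>inner\<close> edges arise inside a cell; the \<open>outer\<close> ones refine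
  an edge of the previous level and inherit its type.\<close>

lemma rep_typed_induct [consumes 1, case_names inner outer]:
  assumes "((u, v), t) \<in> rep_typed S E tp I m"
    and "\<And>m u a b. u \<in> words S m \<Longrightarrow> (a, b) \<in> E \<Longrightarrow> P (Suc m) (u @ [a]) (u @ [b]) (tp (a, b))"
    and "\<And>m u v a b t. ((u, v), t) \<in> rep_typed S E tp I m \<Longrightarrow> P m u v t \<Longrightarrow> (a, b) \<in> I t \<Longrightarrow>
           P (Suc m) (u @ [a]) (v @ [b]) t"
  shows "P m u v t"
  using assms(1)
proof (induction m arbitrary: u v t)
  case (Suc m)
  then consider
      u' a b where "u = u' @ [a]" "v = u' @ [b]" "t = tp (a, b)" "u' \<in> words S m" "(a, b) \<in> E"
    | u' v' a b where "u = u' @ [a]" "v = v' @ [b]" "((u', v'), t) \<in> rep_typed S E tp I m"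
        "(a, b) \<in> I t"
    by (fastforce simp: rep_typed_Suc)
  then show ?case
    using assms(2,3) Suc.IH by cases auto
qed simp

lemma rep_typed_innerI:
  "u \<in> words S m \<Longrightarrow> (a, b) \<in> E \<Longrightarrow> ((u @ [a], u @ [b]), tp (a, b)) \<in> rep_typed S E tp I (Suc m)"
  by (auto simp: rep_typed_Suc)

lemma rep_typed_outerI:
  "((u, v), t) \<in> rep_typed S E tp I m \<Longrightarrow> (a, b) \<in> I t \<Longrightarrow>
    ((u @ [a], v @ [b]), t) \<in> rep_typed S E tp I (Suc m)"
  by (auto simp: rep_typed_Suc)

lemma rep_typed_snoc_left_iff:
  "((u @ [a], v), t) \<in> rep_typed S E tp I (Suc m) \<longleftrightarrow>
    (\<exists>b. v = u @ [b] \<and> u \<in> words S m \<and> (a, b) \<in> E \<and> t = tp (a, b)) \<or>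
    (\<exists>v' b. v = v' @ [b] \<and> ((u, v'), t) \<in> rep_typed S E tp I m \<and> (a, b) \<in> I t)"
  unfolding rep_typed_Suc by auto

lemma rep_typed_snoc_right_iff:
  "((v, u @ [a]), t) \<in> rep_typed S E tp I (Suc m) \<longleftrightarrow>
    (\<exists>b. v = u @ [b] \<and> u \<in> words S m \<and> (b, a) \<in> E \<and> t = tp (b, a)) \<or>
    (\<exists>v' b. v = v' @ [b] \<and> ((v', u), t) \<in> rep_typed S E tp I m \<and> (b, a) \<in> I t)"
  unfolding rep_typed_Suc by auto

lemma rep_edgesI: "((u, v), t) \<in> rep_typed S E tp I m \<Longrightarrow> (u, v) \<in> rep_edges S E tp I m"
  by (force simp: rep_edges_def)

lemma adj_rep_edges_iff:
  "adj (rep_edges S E tp I m) u v \<longleftrightarrow>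
    (\<exists>t. ((u, v), t) \<in> rep_typed S E tp I m \<or> ((v, u), t) \<in> rep_typed S E tp I m)"
  by (force simp: adj_def rep_edges_def)

lemma IGS_map_gluing:
  assumes "IGS_map S E tp I S' E' tp' I' \<phi>" "(w, v) \<in> E" "(a, b) \<in> I (tp (w, v))"
  shows "(\<phi> w, \<phi> v) \<in> E' \<Longrightarrow> (\<phi> a, \<phi> b) \<in> I' (tp' (\<phi> w, \<phi> v))"
    and "(\<phi> v, \<phi> w) \<in> E' \<Longrightarrow> (\<phi> b, \<phi> a) \<in> I' (tp' (\<phi> v, \<phi> w))"
  using assms unfolding IGS_map_def by blast+

text \<open>The type \<open>t'\<close> of the image edge is remembered together with the way in which \<open>\<phi>\<close> maps
  \<open>I t\<close> to \<open>I t'\<close>; this makes the induction over the levels go through.\<close>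
lemma rep_typed_map:
  assumes map: "IGS_map S E tp I S E tp I \<phi>"
    and adj: "\<And>w v. (w, v) \<in> E \<Longrightarrow> adj E (\<phi> w) (\<phi> v)"
    and "\<phi> ` S \<subseteq> S"
    and "((u, v), t) \<in> rep_typed S E tp I m"
  shows "adj (rep_edges S E tp I m) (map \<phi> u) (map \<phi> v)"
proof -
  have "\<exists>t'. (((map \<phi> u, map \<phi> v), t') \<in> rep_typed S E tp I m \<and>
               (\<forall>a b. (a, b) \<in> I t \<longrightarrow> (\<phi> a, \<phi> b) \<in> I t')) \<or>
             (((map \<phi> v, map \<phi> u), t') \<in> rep_typed S E tp I m \<and>
               (\<forall>a b. (a, b) \<in> I t \<longrightarrow> (\<phi> b, \<phi> a) \<in> I t'))"
    using assms(4)
  proof (induction rule: rep_typed_induct)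
    case (inner m u a b)
    have u: "map \<phi> u \<in> words S m" using inner assms(3) by (intro map_in_words) auto
    from adj[OF inner(2)] consider "(\<phi> a, \<phi> b) \<in> E" | "(\<phi> b, \<phi> a) \<in> E" by (auto simp: adj_def)
    then show ?case
    proof cases
      case 1
      then show ?thesis
        using rep_typed_innerI[OF u 1, of tp I] IGS_map_gluing(1)[OF map inner(2)]
        by (intro exI[of _ "tp (\<phi> a, \<phi> b)"]) simp
    next
      case 2
      then show ?thesis
        using rep_typed_innerI[OF u 2, of tp I] IGS_map_gluing(2)[OF map inner(2)]
        by (intro exI[of _ "tp (\<phi> b, \<phi> a)"]) simp
    qed
  next
    case (outer m u v a b t)
    then show ?case by (fastforce intro: rep_typed_outerI)
  qed
  then show ?thesis by (auto simp: adj_rep_edges_iff)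
qed

section \<open>Cubical systems\<close>

locale cubical =
  fixes d L s :: nat and S :: "sym set" and E :: "(sym \<times> sym) set"
    and I :: "nat \<Rightarrow> (sym \<times> sym) set"
  assumes d_ge_1: "d \<ge> 1" and s_ge_1: "s \<ge> 1" and L_ge_3: "L \<ge> 3"
    and cubical: "cubical_IGS d L s S E I"
begin

abbreviation typed_edges :: "nat \<Rightarrow> ((sym list \<times> sym list) \<times> nat) set" where
  "typed_edges \<equiv> rep_typed S E (cube_tp d) I"

abbreviation edges :: "nat \<Rightarrow> (sym list \<times> sym list) set" where
  "edges \<equiv> rep_edges S E (cube_tp d) I"

text \<open>A symbol on the first sheet at position \<open>i\<close> in direction \<open>t\<close>,
  all other coordinates being \<open>x\<close>. For \<open>x\<close> in \<open>{1, L}\<close> and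
  \<open>i\<close> in \<open>{1..L}\<close> it satisfies \<open>star_cond\<close>, so these symbols,
  their edges and their gluings exist in every cubical system.\<close>

definition line_sym :: "nat \<Rightarrow> nat \<Rightarrow> nat \<Rightarrow> sym" where
  "line_sym t x i = ((replicate d x)[t := i], 1)"

text \<open>Allowing \<open>k = 0\<close>, where this is the identity, treats type \<open>0\<close>
  like the other types, although \<open>cube_G\<close> only has swaps of two different
  coordinates.\<close>

definition swap :: "nat \<Rightarrow> sym \<Rightarrow> sym" where
  "swap k = alpha_plus 0 k"

lemma sub: "sub_system S E (cube_tp d) {..<d} I
    (cube_syms d L s) (cube_E d L s) (cube_tp d) {..<d} (cube_I d L s)"
  using cubical unfolding cubical_IGS_def by blast

lemma IGS: "IGS S E (cube_tp d) {..<d} I"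
  using sub unfolding sub_system_def by blast

lemma finite_S: "finite S" and E_sub: "E \<subseteq> S \<times> S"
  and E_asym: "(x, y) \<in> E \<Longrightarrow> (y, x) \<notin> E"
  and tp_lt: "e \<in> E \<Longrightarrow> cube_tp d e < d"
  and I_ne: "t < d \<Longrightarrow> I t \<noteq> {}" and I_sub: "t < d \<Longrightarrow> I t \<subseteq> S \<times> S"
  using IGS unfolding IGS_def by blast+

lemma S_sub: "S \<subseteq> cube_syms d L s"
  using sub unfolding sub_system_def by blast

lemma cube_tp_eq: "cube_edge d L s j w v \<Longrightarrow> cube_tp d (w, v) = j"
  unfolding cube_tp_def cube_edge_def by (auto intro!: Least_equality)

lemmas star_in_S =
    cubical[unfolded cubical_IGS_def, THEN conjunct2, THEN conjunct1, rule_format]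
  and star_edge =
    cubical[unfolded cubical_IGS_def, THEN conjunct2, THEN conjunct2, THEN conjunct1, rule_format]
  and star_gluing =
    cubical[unfolded cubical_IGS_def, THEN conjunct2, THEN conjunct2, THEN conjunct2, THEN conjunct1,
      rule_format]
  and symmetry =
    cubical[unfolded cubical_IGS_def, THEN conjunct2, THEN conjunct2, THEN conjunct2, THEN conjunct2,
      rule_format]

section \<open>Symbols along the edges of the cube\<close>

lemma star_line_sym: "t < d \<Longrightarrow> x \<in> {1, L} \<Longrightarrow> i \<in> {1..L} \<Longrightarrow> star_cond d L s t (line_sym t x i)"
  using s_ge_1 L_ge_3 by (auto simp: star_cond_def line_sym_def cube_syms_def nth_list_update)

lemma line_sym_in_S: "t < d \<Longrightarrow> x \<in> {1, L} \<Longrightarrow> i \<in> {1..L} \<Longrightarrow> line_sym t x i \<in> S"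
  by (rule star_in_S[OF _ star_line_sym])

lemma line_sym_edge:
  assumes "t < d" "x \<in> {1, L}" "1 \<le> i" "i < L"
  shows "(line_sym t x i, line_sym t x (Suc i)) \<in> E"
    and "cube_edge d L s t (line_sym t x i) (line_sym t x (Suc i))"
proof -
  have st: "star_cond d L s t (line_sym t x i)" "star_cond d L s t (line_sym t x (Suc i))"
    using assms by (auto intro!: star_line_sym)
  then show "(line_sym t x i, line_sym t x (Suc i)) \<in> E"
    using assms(1) by (intro star_edge[of t]) (auto simp: line_sym_def)
  show "cube_edge d L s t (line_sym t x i) (line_sym t x (Suc i))"
    using st assms by (auto simp: cube_edge_def star_cond_def line_sym_def)
qed

lemma line_sym_gluing:
  assumes "t < d" "x \<in> {1, L}"
  shows "(line_sym t x L, line_sym t x 1) \<in> I t"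
proof -
  have "star_cond d L s t (line_sym t x L)" "star_cond d L s t (line_sym t x 1)"
    using assms L_ge_3 by (auto intro!: star_line_sym)
  then show ?thesis
    using assms(1) by (intro star_gluing[of t]) (auto simp: line_sym_def)
qed

section \<open>Orientation of edges and gluing rules\<close>

lemma map_id: "IGS_map S E (cube_tp d) I (cube_syms d L s) (cube_E d L s) (cube_tp d) (cube_I d L s) id"
  using sub unfolding sub_system_def by blast

text \<open>The inclusion is allowed to reverse edges, but by (C2) at least one edge of each type
  keeps its orientation; this fixes the orientation of the gluing rules and thereby of all other
  edges.\<close>
lemma I_cube:
  assumes "t < d" "(a, b) \<in> I t"
  shows "(a, b) \<in> cube_I d L s t"
proof -
  have e: "(line_sym t 1 1, line_sym t 1 2) \<in> E" "cube_edge d L s t (line_sym t 1 1) (line_sym t 1 2)"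
    using line_sym_edge[OF assms(1), of 1 1] L_ge_3 by (auto simp: numeral_2_eq_2)
  then show ?thesis
    using IGS_map_gluing(1)[OF map_id e(1), of a b] assms(2)
    by (auto simp: cube_tp_eq cube_E_def)
qed

lemma E_cube:
  assumes "(w, v) \<in> E"
  shows "cube_edge d L s (cube_tp d (w, v)) w v"
proof -
  define t where "t = cube_tp d (w, v)"
  have t: "t < d" using tp_lt[OF assms] by (simp add: t_def)
  have "w \<noteq> v" using E_asym assms by blast
  then have "adj (cube_E d L s) w v"
    using map_id assms unfolding IGS_map_def graph_map_def by auto
  \<comment> \<open>A reversed edge would reverse its gluing pairs, so that coordinate
    \<open>t\<close> of \<open>b\<close> would be both \<open>1\<close> and
    \<open>L\<close>.\<close>
  moreover have "(v, w) \<notin> cube_E d L s"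
  proof
    assume vw: "(v, w) \<in> cube_E d L s"
    have "cube_tp d (v, w) = t"
      unfolding t_def cube_tp_def by (simp add: eq_commute)
    obtain a b where ab: "(a, b) \<in> I t" using I_ne[OF t] by auto
    have "(b, a) \<in> cube_I d L s t"
      using IGS_map_gluing(2)[OF map_id assms, of a b] ab vw \<open>cube_tp d (v, w) = t\<close>
      by (simp add: t_def)
    then show False
      using I_cube[OF t ab] L_ge_3 by (auto simp: cube_I_def)
  qed
  ultimately obtain j where "cube_edge d L s j w v"
    by (auto simp: adj_def cube_E_def)
  then show ?thesis using cube_tp_eq by metis
qed

lemma edges_sub: "edges m \<subseteq> words S m \<times> words S m"
proof -
  have "u \<in> words S m \<and> v \<in> words S m \<and> t < d" if "((u, v), t) \<in> typed_edges m" for u v t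
    using that
  proof (induction rule: rep_typed_induct)
    case (inner m u a b)
    then show ?case using E_sub tp_lt by auto
  next
    case (outer m u v a b t)
    then show ?case using I_sub by auto
  qed
  then show ?thesis by (fastforce simp: rep_edges_def)
qed

lemma typed_edges_lt: "((u, v), t) \<in> typed_edges m \<Longrightarrow> t < d"
  by (induction rule: rep_typed_induct) (auto intro: tp_lt)

text \<open>Bijective base-\<open>L\<close> numeration with digits \<open>1..L\<close>: crossing from the digit \<open>L\<close> of one cell to
  the digit \<open>1\<close> of the next one increases the value by one, as does a step inside a cell.\<close>
definition val :: "nat \<Rightarrow> sym list \<Rightarrow> nat" where
  "val i u = foldl (\<lambda>n a. L * n + fst a ! i) 0 u"

lemma val_Nil [simp]: "val i [] = 0" and val_snoc [simp]: "val i (u @ [a]) = L * val i u + fst a ! i"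
  by (simp_all add: val_def)

lemma val_edge:
  assumes "((u, v), t) \<in> typed_edges m" "i < d"
  shows "val i v = val i u + of_bool (i = t)"
  using assms(1)
proof (induction rule: rep_typed_induct)
  case (inner m u a b)
  then show ?case using E_cube[OF inner(2)] assms(2) by (auto simp: cube_edge_def)
next
  case (outer m u v a b t)
  have t: "t < d" using outer.hyps(1) typed_edges_lt by blast
  show ?case using outer.IH I_cube[OF t outer.hyps(2)] assms(2) by (auto simp: cube_I_def)
qed

lemma coord_bounds: "a \<in> S \<Longrightarrow> i < d \<Longrightarrow> 1 \<le> fst a ! i \<and> fst a ! i \<le> L"
  using S_sub by (auto simp: cube_syms_def)

lemma length_coords: "a \<in> S \<Longrightarrow> length (fst a) = d"
  using S_sub by (auto simp: cube_syms_def)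

lemma coords_ne: "a \<in> S \<Longrightarrow> fst a \<noteq> []"
  using length_coords[of a] d_ge_1 by auto

lemma digit_unique:
  fixes x y a b :: nat
  assumes "L * x + a = L * y + b" "1 \<le> a" "a \<le> L" "1 \<le> b" "b \<le> L"
  shows "x = y \<and> a = b"
proof -
  \<comment> \<open>For \<open>x > y\<close> the left side is at least \<open>L * y + L + 1\<close>,
    out of reach of a digit \<open>b \<le> L\<close>.\<close>
  have *: False if "L * x + a = L * y + b" "1 \<le> a" "b \<le> L" "x > y" for x y a b :: nat
  proof -
    have "L * Suc y \<le> L * x" using that by (intro mult_le_mono) auto
    then show False using that by simp
  qed
  have "x = y" using *[of x a y b] *[of y b x a] assms by (metis linorder_neqE_nat)
  then show ?thesis using assms by simp
qed

text \<open>Uniqueness of digits, applied letter by letter from the end; it shows below that the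
  swap fixes words on the diagonal.\<close>

lemma val_eq_imp:
  assumes "u \<in> words S m" "i < d" "j < d" "val i u = val j u" "a \<in> set u"
  shows "fst a ! i = fst a ! j"
  using assms
proof (induction m arbitrary: u)
  case (Suc m)
  obtain u' b where u: "u = u' @ [b]" using Suc.prems(1) by (cases u rule: rev_cases) (auto simp: words_def)
  then have "u' \<in> words S m" "b \<in> S" using Suc.prems by auto
  moreover from this have "val i u' = val j u' \<and> fst b ! i = fst b ! j"
    using Suc.prems coord_bounds u by (intro digit_unique) auto
  ultimately show ?case using Suc.IH[of u'] Suc.prems(2,3,5) u by auto
qed (simp add: words_def)

text \<open>Locates the faces of type \<open>0\<close> relative to the diagonal: their letters have
  the extreme value \<open>1\<close> or \<open>L\<close> in coordinate \<open>0\<close>.\<close>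

lemma val_mono:
  assumes "u \<in> words S m" "i < d" "j < d" "\<And>a. a \<in> set u \<Longrightarrow> fst a ! i \<le> fst a ! j"
  shows "val i u \<le> val j u"
  using assms
proof (induction m arbitrary: u)
  case (Suc m)
  obtain u' b where u: "u = u' @ [b]" using Suc.prems(1) by (cases u rule: rev_cases) (auto simp: words_def)
  then have "u' \<in> words S m" "fst b ! i \<le> fst b ! j" "val i u' \<le> val j u'"
    using Suc.prems Suc.IH[of u'] by auto
  then show ?case using u by (auto intro!: add_mono mult_le_mono)
qed (simp add: words_def)

subsection \<open>Degrees\<close>

lemma finite_nbrs: "finite {v. ((u, v), t) \<in> typed_edges m}" "finite {v. ((v, u), t) \<in> typed_edges m}"
proof -
  have "{v. ((u, v), t) \<in> typed_edges m} \<subseteq> words S m" "{v. ((v, u), t) \<in> typed_edges m} \<subseteq> words S m"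
    using edges_sub rep_edgesI by fast+
  then show "finite {v. ((u, v), t) \<in> typed_edges m}" "finite {v. ((v, u), t) \<in> typed_edges m}"
    using finite_words[OF finite_S] finite_subset by blast+
qed

text \<open>A last digit \<open>L\<close> excludes steps inside the last cell, while any other last digit excludes
  steps to a neighbouring cell; in the first case the last letter of the neighbour is determined.\<close>
lemma card_out_nbrs:
  assumes "t < d"
  shows "card {v. ((u, v), t) \<in> typed_edges m} \<le> card S"
proof (induction m arbitrary: u)
  case (Suc m)
  show ?case
  proof (cases u rule: rev_cases)
    case (snoc u' a)
    show ?thesis
    proof (cases "fst a ! t = L")
      case True
      have "v \<in> (\<lambda>v'. v' @ [((fst a)[t := 1], snd a)]) ` {v. ((u', v), t) \<in> typed_edges m}"
        if nbr: "((u, v), t) \<in> typed_edges (Suc m)" for v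
      proof -
        have "\<not> cube_edge d L s t a b" for b
          using True by (auto simp: cube_edge_def cube_syms_def)
        then obtain v' b where v: "v = v' @ [b]" "((u', v'), t) \<in> typed_edges m" "(a, b) \<in> I t"
          using nbr E_cube unfolding snoc rep_typed_snoc_left_iff by metis
        have "b = ((fst a)[t := 1], snd a)"
          using assms I_cube[OF assms v(3)]
          by (auto simp: cube_I_def cube_syms_def prod_eq_iff nth_list_update intro!: nth_equalityI)
        then show ?thesis using v by auto
      qed
      then have "card {v. ((u, v), t) \<in> typed_edges (Suc m)} \<le> card {v. ((u', v), t) \<in> typed_edges m}"
        by (intro surj_card_le finite_nbrs) auto
      then show ?thesis using Suc.IH order_trans by blast
    next
      case False
      have "v \<in> (\<lambda>b. u' @ [b]) ` S" if nbr: "((u, v), t) \<in> typed_edges (Suc m)" for v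
      proof -
        have "(a, b) \<notin> I t" for b using False I_cube[OF assms, of a b] by (auto simp: cube_I_def)
        then show ?thesis using nbr E_sub unfolding snoc rep_typed_snoc_left_iff by blast
      qed
      then show ?thesis by (intro surj_card_le finite_S) auto
    qed
  qed (simp add: rep_typed_Suc)
qed simp

text \<open>Mirror image of the previous bound, with the digits \<open>1\<close> and
  \<open>L\<close> exchanged.\<close>

lemma card_in_nbrs:
  assumes "t < d"
  shows "card {v. ((v, u), t) \<in> typed_edges m} \<le> card S"
proof (induction m arbitrary: u)
  case (Suc m)
  show ?case
  proof (cases u rule: rev_cases)
    case (snoc u' a)
    show ?thesis
    proof (cases "fst a ! t = 1")
      case True
      have "v \<in> (\<lambda>v'. v' @ [((fst a)[t := L], snd a)]) ` {v. ((v, u'), t) \<in> typed_edges m}"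
        if nbr: "((v, u), t) \<in> typed_edges (Suc m)" for v
      proof -
        have "\<not> cube_edge d L s t b a" for b
          using True by (force simp: cube_edge_def cube_syms_def)
        then obtain v' b where v: "v = v' @ [b]" "((v', u'), t) \<in> typed_edges m" "(b, a) \<in> I t"
          using nbr E_cube unfolding snoc rep_typed_snoc_right_iff by metis
        have "b = ((fst a)[t := L], snd a)"
          using assms I_cube[OF assms v(3)]
          by (auto simp: cube_I_def cube_syms_def prod_eq_iff nth_list_update intro!: nth_equalityI)
        then show ?thesis using v by auto
      qed
      then have "card {v. ((v, u), t) \<in> typed_edges (Suc m)} \<le> card {v. ((v, u'), t) \<in> typed_edges m}"
        by (intro surj_card_le finite_nbrs) auto
      then show ?thesis using Suc.IH order_trans by blast
    next
      case False
      have "v \<in> (\<lambda>b. u' @ [b]) ` S" if nbr: "((v, u), t) \<in> typed_edges (Suc m)" for v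
      proof -
        have "(b, a) \<notin> I t" for b using False I_cube[OF assms, of b a] by (auto simp: cube_I_def)
        then show ?thesis using nbr E_sub unfolding snoc rep_typed_snoc_right_iff by blast
      qed
      then show ?thesis by (intro surj_card_le finite_S) auto
    qed
  qed (simp add: rep_typed_Suc)
qed simp

text \<open>Neighbours are counted by type and orientation; the bound does not grow with
  \<open>m\<close>.\<close>

lemma card_nbrs: "card {v. adj (edges m) u v} \<le> d * (2 * card S)"
proof -
  have "{v. adj (edges m) u v} =
      (\<Union>t<d. {v. ((u, v), t) \<in> typed_edges m} \<union> {v. ((v, u), t) \<in> typed_edges m})"
    using typed_edges_lt by (auto simp: adj_rep_edges_iff) blast+
  also have "card \<dots> \<le> (\<Sum>t<d. card ({v. ((u, v), t) \<in> typed_edges m} \<union> {v. ((v, u), t) \<in> typed_edges m}))"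
    by (rule card_UN_le) simp
  also have "\<dots> \<le> (\<Sum>t<d. 2 * card S)"
  proof (rule sum_mono)
    fix t assume "t \<in> {..<d}"
    then show "card ({v. ((u, v), t) \<in> typed_edges m} \<union> {v. ((v, u), t) \<in> typed_edges m}) \<le> 2 * card S"
      using card_Un_le[of "{v. ((u, v), t) \<in> typed_edges m}" "{v. ((v, u), t) \<in> typed_edges m}"]
        card_out_nbrs[of t u m] card_in_nbrs[of t u m] by simp
  qed
  finally show ?thesis by simp
qed

text \<open>Each divergence is a sum of at most \<open>d * (2 * card S)\<close> edge values. This
  will control the energy of the edges to the formal vertices.\<close>

lemma outflow_powr_le:
  assumes "edge_flow (edges m) F" "q > 0"
  shows "(\<Sum>x\<in>words S m. \<bar>outflow (words S m) F x\<bar> powr q)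
    \<le> real (d * (2 * card S)) powr q * pair_energy (words S m) q F"
proof -
  let ?N = "real (d * (2 * card S)) powr q"
  have fin: "finite (words S m)" using finite_words[OF finite_S] .
  have "\<bar>outflow (words S m) F x\<bar> powr q \<le> ?N * (\<Sum>y\<in>words S m. \<bar>F x y\<bar> powr q)" for x
  proof -
    let ?A = "{y. adj (edges m) x y}"
    have A: "?A \<subseteq> words S m" using edges_sub by (auto simp: adj_def)
    have "outflow (words S m) F x = (\<Sum>y\<in>?A. F x y)"
      unfolding outflow_def using A fin
      by (intro sum.mono_neutral_right) (auto intro: edge_flow_zero[OF assms(1)])
    also have "\<bar>\<dots>\<bar> powr q \<le> ?N * (\<Sum>y\<in>?A. \<bar>F x y\<bar> powr q)"
      by (rule abs_sum_powr_le[OF finite_subset[OF A fin] card_nbrs assms(2)])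
    also have "\<dots> \<le> ?N * (\<Sum>y\<in>words S m. \<bar>F x y\<bar> powr q)"
      using A fin by (intro mult_left_mono sum_mono2) auto
    finally show ?thesis .
  qed
  then have "(\<Sum>x\<in>words S m. \<bar>outflow (words S m) F x\<bar> powr q)
      \<le> (\<Sum>x\<in>words S m. ?N * (\<Sum>y\<in>words S m. \<bar>F x y\<bar> powr q))"
    by (intro sum_mono)
  then show ?thesis by (simp add: pair_energy_def sum_distrib_left)
qed

subsection \<open>Symmetries\<close>

lemma symmetry_map:
  assumes "\<alpha> \<in> cube_G d L"
  shows "\<alpha> ` S = S" "IGS_map S E (cube_tp d) I S E (cube_tp d) I \<alpha>"
    "(w, v) \<in> E \<Longrightarrow> adj E (\<alpha> w) (\<alpha> v)"
  using symmetry[OF assms] E_sub unfolding IGS_iso_def by (auto simp: adj_def)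

lemma symmetry_adj:
  assumes "\<alpha> \<in> cube_G d L" "adj (edges m) u v"
  shows "adj (edges m) (map \<alpha> u) (map \<alpha> v)"
proof -
  have "adj (edges m) (map \<alpha> u) (map \<alpha> v)" if "((u, v), t) \<in> typed_edges m" for u v t
    using symmetry_map[OF assms(1)] that by (intro rep_typed_map) auto
  then show ?thesis using assms(2) adj_sym by (metis adj_rep_edges_iff)
qed

lemma swap_mem: "0 < k \<Longrightarrow> k < d \<Longrightarrow> swap k \<in> cube_G d L"
  using d_ge_1 unfolding cube_G_def swap_def by force

lemma swap_0 [simp]: "swap 0 = (\<lambda>a. a)"
  by (simp add: swap_def alpha_plus_def fun_eq_iff)

lemma eta_mem: "t < d \<Longrightarrow> eta L t \<in> cube_G d L"
  by (auto simp: cube_G_def)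

lemma swap_in_S: "k < d \<Longrightarrow> a \<in> S \<Longrightarrow> swap k a \<in> S"
  using symmetry_map(1)[OF swap_mem[of k]] by (cases "k = 0") auto

lemma eta_in_S: "t < d \<Longrightarrow> a \<in> S \<Longrightarrow> eta L t a \<in> S"
  using symmetry_map(1)[OF eta_mem[of t]] by auto

lemma swap_adj: "k < d \<Longrightarrow> adj (edges m) u v \<Longrightarrow> adj (edges m) (map (swap k) u) (map (swap k) v)"
  using symmetry_adj[OF swap_mem[of k]] by (cases "k = 0") auto

lemma swap_swap: "k < d \<Longrightarrow> a \<in> S \<Longrightarrow> swap k (swap k a) = a"
  using coords_ne[of a] length_coords[of a]
  by (intro prod_eqI nth_equalityI) (auto simp: swap_def alpha_plus_def nth_list_update)

lemma eta_eta: "t < d \<Longrightarrow> a \<in> S \<Longrightarrow> eta L t (eta L t a) = a"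
  using length_coords[of a] coord_bounds[of a t]
  by (auto simp: eta_def prod_eq_iff nth_list_update intro!: nth_equalityI)

text \<open>Reduces the flip of type \<open>k\<close> to the flip of type \<open>0\<close>, for
  which the symmetric flow is built.\<close>

lemma swap_eta: "k < d \<Longrightarrow> a \<in> S \<Longrightarrow> swap k (eta L k a) = eta L 0 (swap k a)"
  using coords_ne[of a] length_coords[of a] coord_bounds[of a]
  by (intro prod_eqI nth_equalityI) (auto simp: eta_def swap_def alpha_plus_def nth_list_update)

lemma swap_fixed: "k < d \<Longrightarrow> a \<in> S \<Longrightarrow> fst a ! 0 = fst a ! k \<Longrightarrow> swap k a = a"
  using coords_ne[of a] length_coords[of a]
  by (intro prod_eqI nth_equalityI) (auto simp: swap_def alpha_plus_def nth_list_update)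

lemma swap_line_sym:
  assumes "k < d"
  shows "swap k (line_sym 0 1 i) = line_sym k 1 i" "swap k (line_sym k 1 i) = line_sym 0 1 i"
  using assms
  by (auto simp: swap_def alpha_plus_def line_sym_def nth_list_update intro!: nth_equalityI)

text \<open>The swap carries an edge of the line in direction \<open>0\<close> to one in direction
  \<open>k\<close> with its orientation, and conversely; the gluing condition for mappings of
  systems then applies to the whole rule.\<close>

lemma swap_gluing:
  assumes "k < d"
  shows "(a, b) \<in> I 0 \<Longrightarrow> (swap k a, swap k b) \<in> I k"
    and "(a, b) \<in> I k \<Longrightarrow> (swap k a, swap k b) \<in> I 0"
proof -
  have e: "(line_sym t 1 1, line_sym t 1 2) \<in> E" "cube_tp d (line_sym t 1 1, line_sym t 1 2) = t"
    if "t < d" for t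
    using line_sym_edge[OF that, of 1 1] L_ge_3 cube_tp_eq by (auto simp: numeral_2_eq_2)
  have 0: "0 < d" using d_ge_1 by simp
  show "(swap k a, swap k b) \<in> I k" if "(a, b) \<in> I 0"
    using that IGS_map_gluing(1)[OF symmetry_map(2)[OF swap_mem[OF _ assms]] e(1)[OF 0], of a b]
    unfolding swap_line_sym[OF assms] e(2)[OF 0] e(2)[OF assms] using e(1)[OF assms]
    by (cases "k = 0") auto
  show "(swap k a, swap k b) \<in> I 0" if "(a, b) \<in> I k"
    using that IGS_map_gluing(1)[OF symmetry_map(2)[OF swap_mem[OF _ assms]] e(1)[OF assms], of a b]
    unfolding swap_line_sym[OF assms] e(2)[OF 0] e(2)[OF assms] using e(1)[OF 0]
    by (cases "k = 0") auto
qed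

text \<open>The flip maps the first edge of a line to its last edge with reversed orientation, so
  gluing pairs are reversed too.\<close>

lemma eta_gluing:
  assumes "t < d" "(a, b) \<in> I t"
  shows "(eta L t b, eta L t a) \<in> I t"
proof -
  have e: "(line_sym t 1 i, line_sym t 1 (Suc i)) \<in> E"
    "cube_tp d (line_sym t 1 i, line_sym t 1 (Suc i)) = t" if "1 \<le> i" "i < L" for i
    using line_sym_edge[OF assms(1), of 1 i] that cube_tp_eq by auto
  have eta: "eta L t (line_sym t 1 i) = line_sym t 1 (L + 1 - i)" for i
    using assms(1) by (auto simp: eta_def line_sym_def)
  have L: "L + 1 - Suc 1 = L - 1" "L + 1 - 1 = L" "Suc (L - 1) = L" "1 \<le> L - 1" "L - 1 < L" "1 < L"
    using L_ge_3 by auto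
  show ?thesis
    using IGS_map_gluing(2)[OF symmetry_map(2)[OF eta_mem[OF assms(1)]] e(1)[OF order_refl L(6)], of a b]
      e[OF L(4,5)] assms(2)
    unfolding eta L(1,2,3) e(2)[OF order_refl L(6)] by simp
qed

subsection \<open>Faces\<close>

abbreviation face :: "bool \<Rightarrow> nat \<Rightarrow> nat \<Rightarrow> sym list set" where
  "face \<equiv> Iside I"

definition face_syms :: "bool \<Rightarrow> nat \<Rightarrow> sym set" where
  "face_syms b t = (if b then Iplus I t else Iminus I t)"

lemma face_syms_iff: "a \<in> face_syms b t \<longleftrightarrow> (\<exists>c. (if b then (a, c) else (c, a)) \<in> I t)"
  by (force simp: face_syms_def Iplus_def Iminus_def)

lemma face_eq: "face b t m = words (face_syms b t) m"
  by (simp add: Iside_def face_syms_def)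

lemma face_syms_D: "t < d \<Longrightarrow> a \<in> face_syms b t \<Longrightarrow> a \<in> S \<and> fst a ! t = (if b then L else 1)"
  unfolding face_syms_iff using I_cube I_sub by (fastforce simp: cube_I_def split: if_splits)

lemma face_sub: "t < d \<Longrightarrow> face b t m \<subseteq> words S m"
  using face_syms_D by (auto simp: face_eq words_def)

lemma face_coord: "t < d \<Longrightarrow> u \<in> face b t m \<Longrightarrow> a \<in> set u \<Longrightarrow> fst a ! t = (if b then L else 1)"
  using face_syms_D[of t a b] by (auto simp: face_eq words_def)

lemma swap_face_syms:
  assumes "k < d"
  shows "a \<in> face_syms b 0 \<Longrightarrow> swap k a \<in> face_syms b k"
    and "a \<in> face_syms b k \<Longrightarrow> swap k a \<in> face_syms b 0"
  unfolding face_syms_iff by (cases b; metis swap_gluing[OF assms])+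

lemma eta_face_syms: "t < d \<Longrightarrow> a \<in> face_syms b t \<Longrightarrow> eta L t a \<in> face_syms (\<not> b) t"
  unfolding face_syms_iff by (cases b; metis eta_gluing)

lemma swap_face:
  assumes "k < d"
  shows "u \<in> face b 0 m \<Longrightarrow> map (swap k) u \<in> face b k m"
    and "u \<in> face b k m \<Longrightarrow> map (swap k) u \<in> face b 0 m"
  using swap_face_syms[OF assms] by (auto simp: face_eq intro: map_in_words)

lemma eta_face: "t < d \<Longrightarrow> u \<in> face b t m \<Longrightarrow> map (eta L t) u \<in> face (\<not> b) t m"
  using eta_face_syms by (auto simp: face_eq intro: map_in_words)

lemma corner_in_face:
  assumes "t < d" "x \<in> {1, L}"
  shows "replicate m (line_sym t x (if b then L else 1)) \<in> face b t m"
proof -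
  have "line_sym t x (if b then L else 1) \<in> face_syms b t"
    unfolding face_syms_iff using line_sym_gluing[OF assms] by (cases b) metis+
  then show ?thesis by (auto simp: face_eq words_def)
qed

lemma face_inj:
  assumes "face b t m = face b' t' m" "t < d" "t' < d" "m \<ge> 1"
  shows "b = b' \<and> t = t'"
proof -
  \<comment> \<open>The free coordinates of the test corner get the value that the face of
    \<open>b'\<close> and \<open>t'\<close> excludes, so membership forces
    \<open>t = t'\<close>.\<close>
  define x where "x = (if b' then 1 else L)"
  let ?a = "line_sym t x (if b then L else 1)"
  have "replicate m ?a \<in> face b' t' m"
    using corner_in_face[OF assms(2), of x m b] assms(1) by (auto simp: x_def)
  then have "fst ?a ! t' = (if b' then L else 1)"
    using face_coord[OF assms(3)] assms(4) by fastforce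
  then show ?thesis
    using L_ge_3 assms(2,3) by (cases "t = t'") (auto simp: line_sym_def x_def split: if_splits)
qed

lemma face_disjoint: "t < d \<Longrightarrow> m \<ge> 1 \<Longrightarrow> face b t m \<inter> face (\<not> b) t m = {}"
proof (rule ccontr)
  assume t: "t < d" "m \<ge> 1" and "face b t m \<inter> face (\<not> b) t m \<noteq> {}"
  then obtain u where u: "u \<in> face b t m" "u \<in> face (\<not> b) t m" by blast
  then have "hd u \<in> set u" using t by (intro hd_in_set) (auto simp: face_eq words_def)
  then show False
    using face_coord[OF t(1) u(1), of "hd u"] face_coord[OF t(1) u(2), of "hd u"] L_ge_3
    by (auto split: if_splits)
qed

lemma face_ne: "t < d \<Longrightarrow> face b t m \<noteq> {}"
  using corner_in_face[of t 1] by fastforce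

text \<open>Induction on the level: each cell on the coarse path is crossed from digit
  \<open>1\<close> to digit \<open>L\<close>, and the gluing pair of these digits leads into the
  next cell.\<close>

lemma line_path:
  assumes "t < d"
  shows "(replicate m (line_sym t 1 1), replicate m (line_sym t 1 L)) \<in> {(u, v). ((u, v), t) \<in> typed_edges m}\<^sup>*"
proof (induction m)
  case (Suc m)
  let ?R = "\<lambda>m. {(u, v). ((u, v), t) \<in> typed_edges m}"
  have inner: "(u @ [line_sym t 1 1], u @ [line_sym t 1 L]) \<in> (?R (Suc m))\<^sup>*" if "u \<in> words S m" for u
  proof -
    have "(u @ [line_sym t 1 1], u @ [line_sym t 1 i]) \<in> (?R (Suc m))\<^sup>*" if "1 \<le> i" "i \<le> L" for i
      using that
    proof (induction i rule: nat_induct_at_least)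
      case (Suc i)
      have "((u @ [line_sym t 1 i], u @ [line_sym t 1 (Suc i)]), t) \<in> typed_edges (Suc m)"
        using rep_typed_innerI[OF \<open>u \<in> words S m\<close> line_sym_edge(1)[OF assms, of 1 i], of "cube_tp d" I]
          line_sym_edge(2)[OF assms, of 1 i] cube_tp_eq Suc by auto
      then show ?case using Suc by (auto intro: rtrancl_into_rtrancl)
    qed simp
    then show ?thesis using L_ge_3 by auto
  qed
  \<comment> \<open>The coarse path is lifted to the entries of the cells, with last digit
    \<open>1\<close>; the crossing of the final cell is added at the end.\<close>
  have "(replicate m (line_sym t 1 1) @ [line_sym t 1 1], v @ [line_sym t 1 1]) \<in> (?R (Suc m))\<^sup>* \<and> v \<in> words S m"
    if "(replicate m (line_sym t 1 1), v) \<in> (?R m)\<^sup>*" for v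
    using that
  proof (induction rule: rtrancl_induct)
    case base
    then show ?case using line_sym_in_S[OF assms, of 1 1] L_ge_3 by (auto simp: words_def)
  next
    case (step u v)
    have uv: "((u, v), t) \<in> typed_edges m" using step by simp
    have "((u @ [line_sym t 1 L], v @ [line_sym t 1 1]), t) \<in> typed_edges (Suc m)"
      using uv line_sym_gluing[OF assms, of 1] by (intro rep_typed_outerI) auto
    moreover have "v \<in> words S m" using rep_edgesI[OF uv] edges_sub by blast
    ultimately show ?case
      using step.IH inner[of u] by (blast intro: rtrancl_into_rtrancl rtrancl_trans)
  qed
  from this[OF Suc.IH] show ?case
    using inner[of "replicate m (line_sym t 1 L)"]
    unfolding replicate_append_same replicate_Suc by (blast intro: rtrancl_trans)
qed simp

lemma finite_W: "finite (words S m)"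
  using finite_words[OF finite_S] .

text \<open>The path flow from corner to corner along the line; it shows that the infimum in
  \<open>min_energy\<close> is taken over a nonempty set.\<close>

lemma exists_unit_flow:
  assumes "t < d" "m \<ge> 1"
  shows "\<exists>F. unit_flow (words S m) (edges m) (face False t m) (face True t m) F"
proof -
  let ?x = "replicate m (line_sym t 1 1)" and ?y = "replicate m (line_sym t 1 L)"
  obtain F where F: "edge_flow (edges m) F"
    "\<And>z. z \<in> words S m \<Longrightarrow> outflow (words S m) F z = of_bool (z = ?x) - of_bool (z = ?y)"
    using exists_path_flow[OF finite_W line_path[OF assms(1), of m] _ edges_sub, of m]
    by (auto intro: rep_edgesI)
  have xy: "?x \<in> face False t m" "?y \<in> face True t m"
    using corner_in_face[OF assms(1), of 1 m False] corner_in_face[OF assms(1), of 1 m True] by auto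
  have disj: "face False t m \<inter> face True t m = {}" using face_disjoint[OF assms, of False] by simp
  have "(\<Sum>z\<in>face False t m. outflow (words S m) F z) = (\<Sum>z\<in>face False t m. of_bool (z = ?x))"
    using F(2) face_sub[OF assms(1)] xy disj by (intro sum.cong) fastforce+
  also have "\<dots> = 1"
    using xy(1) finite_subset[OF face_sub[OF assms(1)] finite_W] by (simp add: of_bool_def)
  finally have "(\<Sum>z\<in>face False t m. outflow (words S m) F z) = 1" .
  moreover have "outflow (words S m) F z = 0" if "z \<in> words S m - (face False t m \<union> face True t m)" for z
    using F(2)[of z] xy that by auto
  ultimately have "unit_flow (words S m) (edges m) (face False t m) (face True t m) F"
    unfolding unit_flow_iff[OF finite_W] using F(1) disj face_sub[OF assms(1)] face_ne[OF assms(1)]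
    by (intro conjI ballI) simp_all
  then show ?thesis by blast
qed

subsection \<open>Symmetrisation and folding\<close>

lemma map_swap_W: "k < d \<Longrightarrow> u \<in> words S m \<Longrightarrow> map (swap k) u \<in> words S m"
  by (rule map_in_words[OF _ swap_in_S])

lemma map_swap_swap: "k < d \<Longrightarrow> u \<in> words S m \<Longrightarrow> map (swap k) (map (swap k) u) = u"
  using map_map_words[of u S m "swap k" "swap k" id] swap_swap by simp

lemma map_eta_W: "t < d \<Longrightarrow> u \<in> words S m \<Longrightarrow> map (eta L t) u \<in> words S m"
  by (rule map_in_words[OF _ eta_in_S])

lemma map_eta_eta: "t < d \<Longrightarrow> u \<in> words S m \<Longrightarrow> map (eta L t) (map (eta L t) u) = u"
  using map_map_words[of u S m "eta L t" "eta L t" id] eta_eta by simp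

lemma map_swap_eta:
  "k < d \<Longrightarrow> u \<in> words S m \<Longrightarrow> map (swap k) (map (eta L k) u) = map (eta L 0) (map (swap k) u)"
  using map_map_words[of u S m "swap k" "eta L k" "\<lambda>a. eta L 0 (swap k a)"] swap_eta by simp

declare map_map [simp del]

text \<open>An involution has singleton fibers, so the push-forward merely relabels the vertices;
  the factor \<open>4 powr q\<close> is that of the general estimate.\<close>

lemma push_involution:
  assumes "edge_flow (edges m) F" "q > 0"
    and A: "\<forall>u\<in>words S m. A u \<in> words S m" "\<forall>u\<in>words S m. A (A u) = u"
      "\<forall>u v. adj (edges m) u v \<longrightarrow> adj (edges m) (A u) (A v)"
  shows "edge_flow (edges m) (push_flow (words S m) A F)"
    and "x \<in> words S m \<Longrightarrow> outflow (words S m) (push_flow (words S m) A F) x = outflow (words S m) F (A x)"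
    and "pair_energy (words S m) q (push_flow (words S m) A F) \<le> 4 powr q * pair_energy (words S m) q F"
proof -
  have AW: "A ` words S m \<subseteq> words S m" using A(1) by auto
  have fib: "fiber (words S m) A x = {A x}" if "x \<in> words S m" for x
    using that A(2) by (intro fiber_involution[OF AW]) auto
  show "edge_flow (edges m) (push_flow (words S m) A F)"
    using assms(1) A(3) by (intro edge_flow_push) auto
  show "outflow (words S m) (push_flow (words S m) A F) x = outflow (words S m) F (A x)"
    if "x \<in> words S m"
    using that by (simp add: outflow_push[OF finite_W AW] fib)
  show "pair_energy (words S m) q (push_flow (words S m) A F) \<le> 4 powr q * pair_energy (words S m) q F"
    using assms(2) by (intro pair_energy_push finite_W AW) (simp_all add: fib)
qed

text \<open>Reflection into the half \<open>val 0 \<le> val k\<close>. The side is decided by the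
  numerals of the whole word, and all letters are swapped at once, which is what keeps adjacent
  words adjacent.\<close>

definition fold_word :: "nat \<Rightarrow> sym list \<Rightarrow> sym list" where
  "fold_word k u = (if val 0 u \<le> val k u then u else map (swap k) u)"

lemma fold_word_W: "k < d \<Longrightarrow> u \<in> words S m \<Longrightarrow> fold_word k u \<in> words S m"
  by (simp add: fold_word_def map_swap_W)

lemma map_swap_diagonal:
  assumes "k < d" "u \<in> words S m" "val 0 u = val k u"
  shows "map (swap k) u = u"
proof (rule map_idI)
  fix a assume a: "a \<in> set u"
  then have "a \<in> S" using assms(2) by (auto simp: words_def)
  then show "swap k a = a"
    using swap_fixed[OF assms(1)] val_eq_imp[OF assms(2) _ assms(1,3) a] d_ge_1 by simp
qed

text \<open>Along an edge at most one of the two coordinates changes, and by one only; hence an edge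
  leaving the half \<open>val 0 \<le> val k\<close> starts on the diagonal, which the swap fixes.\<close>
lemma fold_word_adj:
  assumes "k < d" "u \<in> words S m" "v \<in> words S m" "adj (edges m) u v"
  shows "adj (edges m) (fold_word k u) (fold_word k v)"
proof -
  have diag: "map (swap k) u = u"
    if "adj (edges m) u v" "u \<in> words S m" "val 0 u \<le> val k u" "\<not> val 0 v \<le> val k v" for u v
  proof (rule map_swap_diagonal[OF assms(1) that(2)])
    have d: "0 < d" using d_ge_1 by simp
    obtain t where "((u, v), t) \<in> typed_edges m \<or> ((v, u), t) \<in> typed_edges m"
      using \<open>adj (edges m) u v\<close> by (auto simp: adj_rep_edges_iff)
    then show "val 0 u = val k u"
      using val_edge[OF _ d, of u v t m] val_edge[OF _ d, of v u t m]
        val_edge[OF _ assms(1), of u v t m] val_edge[OF _ assms(1), of v u t m] that(3,4)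
      by (auto simp: of_bool_def split: if_splits)
  qed
  show ?thesis
    using diag[of u v] diag[of v u] swap_adj[OF assms(1,4)] assms adj_sym[of "edges m"]
    by (auto simp: fold_word_def)
qed

text \<open>Coordinate \<open>0\<close> has its least value \<open>1\<close> in every letter, so the
  face lies in the half that is left alone.\<close>

lemma fold_word_face_minus:
  assumes "k < d" "u \<in> face False 0 m"
  shows "fold_word k u = u"
proof -
  have d: "0 < d" using d_ge_1 by simp
  have u: "u \<in> words S m" using face_sub[OF d] assms(2) by blast
  have "val 0 u \<le> val k u"
  proof (rule val_mono[OF u d assms(1)])
    fix a assume a: "a \<in> set u"
    then have "a \<in> S" using u by (auto simp: words_def)
    then show "fst a ! 0 \<le> fst a ! k"
      using face_coord[OF d assms(2) a] coord_bounds[of a k] assms(1) by simp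
  qed
  then show ?thesis by (simp add: fold_word_def)
qed

text \<open>Coordinate \<open>0\<close> has its largest value \<open>L\<close> in every letter, so
  the word is reflected or lies on the diagonal, where the swap does nothing.\<close>

lemma fold_word_face_plus:
  assumes "k < d" "u \<in> face True 0 m"
  shows "fold_word k u = map (swap k) u"
proof -
  have d: "0 < d" using d_ge_1 by simp
  have u: "u \<in> words S m" using face_sub[OF d] assms(2) by blast
  have "val k u \<le> val 0 u"
  proof (rule val_mono[OF u assms(1) d])
    fix a assume a: "a \<in> set u"
    then have "a \<in> S" using u by (auto simp: words_def)
    then show "fst a ! k \<le> fst a ! 0"
      using face_coord[OF d assms(2) a] coord_bounds[of a k] assms(1) by simp
  qed
  then show ?thesis using map_swap_diagonal[OF assms(1) u] by (simp add: fold_word_def)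
qed

lemma card_fiber_fold_word:
  assumes "k < d"
  shows "card (fiber (words S m) (fold_word k) x) \<le> 2"
proof -
  have "fiber (words S m) (fold_word k) x \<subseteq> {x, map (swap k) x}"
    using map_swap_swap[OF assms] by (auto simp: fiber_def fold_word_def split: if_splits)
  then have "card (fiber (words S m) (fold_word k) x) \<le> card {x, map (swap k) x}"
    by (intro card_mono) auto
  also have "\<dots> \<le> 2" by (simp add: card_insert_if)
  finally show ?thesis .
qed

text \<open>A unit flow between the two faces of type \<open>0\<close> whose sink values mirror its
  source values \<open>f\<close>; all later divergences are written through this one
  function.\<close>

definition symmetric_flow :: "nat \<Rightarrow> (sym list \<Rightarrow> sym list \<Rightarrow> real) \<Rightarrow> (sym list \<Rightarrow> real) \<Rightarrow> bool" where
  "symmetric_flow m H f \<longleftrightarrow> edge_flow (edges m) H \<and>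
     (\<forall>x\<in>words S m. outflow (words S m) H x = f x - f (map (eta L 0) x)) \<and>
     (\<forall>x. f x \<noteq> 0 \<longrightarrow> x \<in> face False 0 m) \<and> (\<Sum>x\<in>words S m. f x) = 1"

lemma exists_symmetric_flow:
  assumes F: "unit_flow (words S m) (edges m) (face False 0 m) (face True 0 m) F"
    and q: "q > 0" and "m \<ge> 1"
  shows "\<exists>H f. symmetric_flow m H f \<and>
    pair_energy (words S m) q H \<le> 2 powr q * (1 + 4 powr q) * pair_energy (words S m) q F"
proof -
  have d: "0 < d" using d_ge_1 by simp
  let ?W = "words S m" and ?eta = "map (eta L 0)"
  let ?A = "face False 0 m" and ?B = "face True 0 m"
  define g where "g = outflow ?W F"
  define G where "G = push_flow ?W ?eta F"
  \<comment> \<open>The flip exchanges source and sink, so \<open>G\<close> runs backwards; half the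
    difference is again a unit flow, and its divergence is odd under the flip.\<close>
  define H where "H = (\<lambda>x y. 1/2 * (F x y - G x y))"
  \<comment> \<open>The divergence on the source face; on the sink face oddness gives
    \<open>- f\<close> of the flipped word.\<close>
  define f where "f x = (if x \<in> ?A then 1/2 * (g x - g (?eta x)) else 0)" for x
  have ef: "edge_flow (edges m) F" and g0: "\<And>x. x \<in> ?W \<Longrightarrow> x \<notin> ?A \<Longrightarrow> x \<notin> ?B \<Longrightarrow> g x = 0"
    and gA: "sum g ?A = 1"
    using F unfolding unit_flow_iff[OF finite_W] g_def by auto
  have AW: "?A \<subseteq> ?W" and BW: "?B \<subseteq> ?W" using face_sub[OF d] by auto
  have disj: "?A \<inter> ?B = {}" using face_disjoint[OF d assms(3), of False] by simp
  have eA: "?eta x \<in> ?B" if "x \<in> ?A" for x using eta_face[OF d that] by simp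
  have eB: "?eta x \<in> ?A" if "x \<in> ?B" for x using eta_face[OF d that] by simp
  have eW: "?eta x \<in> ?W" if "x \<in> ?W" for x using map_eta_W[OF d that] .
  have ee: "?eta (?eta x) = x" if "x \<in> ?W" for x using map_eta_eta[OF d that] .
  have "\<forall>x\<in>?W. ?eta x \<in> ?W" "\<forall>x\<in>?W. ?eta (?eta x) = x"
    "\<forall>u v. adj (edges m) u v \<longrightarrow> adj (edges m) (?eta u) (?eta v)"
    using eW ee symmetry_adj[OF eta_mem[OF d]] by blast+
  note G = push_involution[OF ef q this, folded G_def]
  have HG: "outflow ?W H x = 1/2 * (g x - g (?eta x))" if "x \<in> ?W" for x
    unfolding H_def outflow_scale outflow_diff using G(2)[OF that] by (simp add: g_def)
  have "outflow ?W H x = f x - f (?eta x)" if x: "x \<in> ?W" for x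
  proof -
    consider "x \<in> ?A" "x \<notin> ?B" | "x \<in> ?B" "x \<notin> ?A" | "x \<notin> ?A" "x \<notin> ?B" using disj by blast
    then show ?thesis
    proof cases
      case 1
      then have "?eta x \<notin> ?A" using eA disj by blast
      then show ?thesis using 1 by (simp add: HG[OF x] f_def)
    next
      case 2
      then show ?thesis using eB[of x] by (simp add: HG[OF x] f_def ee[OF x] field_simps)
    next
      case 3
      then have "?eta x \<notin> ?A" "?eta x \<notin> ?B" using eA[of "?eta x"] eB[of "?eta x"] ee[OF x] by auto
      then show ?thesis using 3 g0[OF x] g0[OF eW[OF x]] by (simp add: HG[OF x] f_def)
    qed
  qed
  moreover have "(\<Sum>x\<in>?W. f x) = 1"
  proof -
    \<comment> \<open>The total divergence vanishes, so the sink face receives \<open>-1\<close>,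
      and averaging with the flipped flow keeps the total \<open>1\<close>.\<close>
    have "(\<Sum>x\<in>?W. g x) = 0"
      unfolding g_def outflow_def using edge_flow_antisym[OF ef] by (rule sum_sum_antisym_eq_0)
    also have "(\<Sum>x\<in>?W. g x) = (\<Sum>x\<in>?A \<union> ?B. g x)"
      using AW BW finite_W g0 by (intro sum.mono_neutral_right) auto
    also have "\<dots> = sum g ?A + sum g ?B"
      using AW BW finite_W finite_subset disj by (intro sum.union_disjoint) blast+
    finally have gB: "sum g ?B = -1" using gA by simp
    have "(\<Sum>x\<in>?W. f x) = (\<Sum>x\<in>?A. 1/2 * (g x - g (?eta x)))"
      unfolding f_def using AW finite_W by (subst sum.mono_neutral_cong_right[of ?W ?A]) auto
    also have "\<dots> = 1/2 * (sum g ?A - (\<Sum>x\<in>?A. g (?eta x)))"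
      by (simp add: sum_subtractf flip: sum_distrib_left sum_divide_distrib)
    also have "(\<Sum>x\<in>?A. g (?eta x)) = sum g ?B"
      using eA eB ee AW BW by (intro sum.reindex_bij_witness[where i = ?eta and j = ?eta]) auto
    finally show ?thesis using gA gB by simp
  qed
  moreover have "edge_flow (edges m) H"
    unfolding H_def by (intro edge_flow_scale edge_flow_diff ef G(1))
  moreover have "pair_energy ?W q H \<le> 2 powr q * (1 + 4 powr q) * pair_energy ?W q F"
  proof -
    let ?e = "pair_energy ?W q F"
    have "pair_energy ?W q H = (1/2) powr q * pair_energy ?W q (\<lambda>x y. F x y - G x y)"
      unfolding H_def pair_energy_scale by simp
    also have "\<dots> \<le> 1 * pair_energy ?W q (\<lambda>x y. F x y - G x y)"
      using powr_mono2[of q "1/2" 1] q pair_energy_nonneg by (intro mult_right_mono) auto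
    also have "\<dots> \<le> 2 powr q * (?e + pair_energy ?W q G)"
      using pair_energy_diff_le[OF q] by simp
    also have "\<dots> \<le> 2 powr q * (?e + 4 powr q * ?e)"
      using G(3) by (intro mult_left_mono add_left_mono) auto
    finally show ?thesis by (simp add: algebra_simps)
  qed
  ultimately show ?thesis
    unfolding symmetric_flow_def by (intro exI[of _ H] exI[of _ f]) (auto simp: f_def)
qed

text \<open>The source profile \<open>f\<close> transported to an arbitrary face: the swap leads
  from type \<open>k\<close> to type \<open>0\<close>, and for the upper face the flip leads on to
  the lower one.\<close>

definition face_weight :: "nat \<Rightarrow> (sym list \<Rightarrow> real) \<Rightarrow> bool \<Rightarrow> nat \<Rightarrow> sym list \<Rightarrow> real" where
  "face_weight m f b k x = (if x \<in> face b k m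
     then f (if b then map (eta L 0) (map (swap k) x) else map (swap k) x) else 0)"

text \<open>The transport takes only words of \<open>face b k m\<close> into the support of
  \<open>f\<close>, so both sides vanish outside this face.\<close>

lemma face_weight_eq:
  assumes "symmetric_flow m H f" "k < d" "x \<in> words S m"
  shows "face_weight m f b k x = f (if b then map (eta L 0) (map (swap k) x) else map (swap k) x)"
proof -
  have d: "0 < d" using d_ge_1 by simp
  let ?y = "map (swap k) x"
  have y: "?y \<in> words S m" using map_swap_W[OF assms(2,3)] .
  have supp: "u \<in> face False 0 m" if "f u \<noteq> 0" for u
    using assms(1) that by (auto simp: symmetric_flow_def)
  have x: "x \<in> face b k m" if "?y \<in> face b 0 m" for b
    using swap_face(1)[OF assms(2) that] unfolding map_swap_swap[OF assms(2,3)] .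
  have y': "?y \<in> face True 0 m" if "map (eta L 0) ?y \<in> face False 0 m"
    using eta_face[OF d that] unfolding map_eta_eta[OF d y] by simp
  show ?thesis using supp x y' by (cases b) (auto simp: face_weight_def)
qed

text \<open>Every face is joined to \<open>I\<^bsub>0,-\<^esub>\<close>: the fold carries the symmetric flow between the faces of type
  \<open>0\<close> to one from \<open>I\<^bsub>0,-\<^esub>\<close> to \<open>I\<^bsub>k,+\<^esub>\<close>, and the swap to one from \<open>I\<^bsub>k,-\<^esub>\<close> to \<open>I\<^bsub>k,+\<^esub>\<close>.\<close>
lemma exists_flow_to_root:
  assumes H: "symmetric_flow m H f" and q: "q > 0" and k: "k < d"
  shows "\<exists>h. edge_flow (edges m) h \<and>
    (\<forall>x\<in>words S m. outflow (words S m) h x = face_weight m f b k x - f x) \<and>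
    pair_energy (words S m) q h \<le> 2 powr q * (2 * 4 powr q) * pair_energy (words S m) q H"
proof -
  have d: "0 < d" using d_ge_1 by simp
  let ?W = "words S m" and ?swap = "map (swap k)" and ?eta = "map (eta L 0)"
  let ?e = "pair_energy (words S m) q H"
  have ef: "edge_flow (edges m) H" and Hf: "\<And>x. x \<in> ?W \<Longrightarrow> outflow ?W H x = f x - f (?eta x)"
    and supp: "\<And>x. f x \<noteq> 0 \<Longrightarrow> x \<in> face False 0 m"
    using H by (auto simp: symmetric_flow_def)
  define P where "P = push_flow ?W (fold_word k) H"
  define Q where "Q = push_flow ?W ?swap H"
  have "\<forall>x\<in>?W. ?swap x \<in> ?W" "\<forall>x\<in>?W. ?swap (?swap x) = x"
    "\<forall>u v. adj (edges m) u v \<longrightarrow> adj (edges m) (?swap u) (?swap v)"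
    using map_swap_W[OF k] map_swap_swap[OF k] swap_adj[OF k] by blast+
  note Q = push_involution[OF ef q this, folded Q_def]
  have foldW: "fold_word k ` ?W \<subseteq> ?W" using fold_word_W[OF k] by auto
  have P1: "edge_flow (edges m) P"
    unfolding P_def using fold_word_adj[OF k] by (intro edge_flow_push[OF ef]) blast
  \<comment> \<open>The fold is the identity on the source face and the swap on the sink face, so
    the two parts of the divergence are transported separately.\<close>
  have P2: "outflow ?W P x = f x - f (?eta (?swap x))" if x: "x \<in> ?W" for x
  proof -
    have "outflow ?W P x = (\<Sum>x'\<in>fiber ?W (fold_word k) x. f x' - f (?eta x'))"
      unfolding P_def outflow_push[OF finite_W foldW] using Hf by (intro sum.cong) (auto simp: fiber_def)
    also have "\<dots> = (\<Sum>x'\<in>fiber ?W (fold_word k) x. f x') - (\<Sum>x'\<in>fiber ?W (fold_word k) x. f (?eta x'))"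
      by (rule sum_subtractf)
    also have "(\<Sum>x'\<in>fiber ?W (fold_word k) x. f x') = f x"
      using sum_fiber_supported[OF finite_W x, of "\<lambda>x. x" f "fold_word k"]
        fold_word_face_minus[OF k] supp by auto
    also have "(\<Sum>x'\<in>fiber ?W (fold_word k) x. f (?eta x')) = f (?eta (?swap x))"
    proof (rule sum_fiber_supported[OF finite_W x])
      show "?swap ` ?W \<subseteq> ?W" using map_swap_W[OF k] by auto
      show "?swap (?swap x) = x" if "x \<in> ?W" for x using map_swap_swap[OF k that] .
      fix x' assume x': "x' \<in> ?W" and "f (?eta x') \<noteq> 0"
      then have "?eta (?eta x') \<in> face True 0 m" using eta_face[OF d supp] by fastforce
      then show "fold_word k x' = ?swap x'"
        using fold_word_face_plus[OF k] map_eta_eta[OF d x'] by simp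
    qed
    finally show ?thesis .
  qed
  have P3: "pair_energy ?W q P \<le> 4 powr q * ?e"
    unfolding P_def by (intro pair_energy_push finite_W foldW q card_fiber_fold_word k)
  \<comment> \<open>For the upper face \<open>- P\<close> alone suffices. For the lower face the
    swapped flow \<open>Q\<close> is added, and the values of \<open>Q\<close> and \<open>P\<close>
    on the upper face of type \<open>k\<close> cancel.\<close>
  define R where "R = (\<lambda>x y. of_bool (\<not> b) * Q x y)"
  have R1: "edge_flow (edges m) R"
    unfolding R_def by (rule edge_flow_scale[OF Q(1)])
  have R2: "outflow ?W R x = of_bool (\<not> b) * (f (?swap x) - f (?eta (?swap x)))" if "x \<in> ?W" for x
    unfolding R_def outflow_scale Q(2)[OF that] Hf[OF map_swap_W[OF k that]] ..
  have R3: "pair_energy ?W q R \<le> 4 powr q * ?e"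
    unfolding R_def pair_energy_scale using Q(3) pair_energy_nonneg[of ?W q H] by (cases b) simp_all
  have "pair_energy ?W q (\<lambda>x y. R x y - P x y) \<le> 2 powr q * (pair_energy ?W q R + pair_energy ?W q P)"
    by (rule pair_energy_diff_le[OF q])
  also have "\<dots> \<le> 2 powr q * (4 powr q * ?e + 4 powr q * ?e)"
    using P3 R3 by (intro mult_left_mono add_mono) auto
  finally have "pair_energy ?W q (\<lambda>x y. R x y - P x y) \<le> 2 powr q * (2 * 4 powr q) * ?e"
    by (simp add: algebra_simps)
  moreover have "outflow ?W (\<lambda>x y. R x y - P x y) x = face_weight m f b k x - f x" if "x \<in> ?W" for x
    unfolding outflow_diff face_weight_eq[OF H k that] R2[OF that] P2[OF that] by (cases b) auto
  ultimately show ?thesis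
    using edge_flow_diff[OF R1 P1] by (intro exI[of _ "\<lambda>x y. R x y - P x y"]) auto
qed

text \<open>The transport permutes the words. A general \<open>\<Phi>\<close> serves both the total
  mass and the \<open>q\<close>-th powers of the weights.\<close>

lemma sum_face_weight:
  fixes \<Phi> :: "real \<Rightarrow> real"
  assumes "symmetric_flow m H f" "k < d" "\<Phi> 0 = 0"
  shows "(\<Sum>x\<in>face b k m. \<Phi> (face_weight m f b k x)) = (\<Sum>x\<in>words S m. \<Phi> (f x))"
proof -
  have d: "0 < d" using d_ge_1 by simp
  define A where "A x = (if b then map (eta L 0) (map (swap k) x) else map (swap k) x)" for x
  define B where "B x = (if b then map (swap k) (map (eta L 0) x) else map (swap k) x)" for x
  have "(\<Sum>x\<in>face b k m. \<Phi> (face_weight m f b k x)) = (\<Sum>x\<in>words S m. \<Phi> (face_weight m f b k x))"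
    using face_sub[OF assms(2)] finite_W assms(3)
    by (intro sum.mono_neutral_left) (auto simp: face_weight_def)
  also have "\<dots> = (\<Sum>x\<in>words S m. \<Phi> (f (A x)))"
    unfolding A_def using face_weight_eq[OF assms(1,2)] by (intro sum.cong) simp_all
  also have "\<dots> = (\<Sum>x\<in>words S m. \<Phi> (f x))"
  proof (rule sum.reindex_bij_witness[where i = B and j = A])
    fix x assume x: "x \<in> words S m"
    note x_W = x map_swap_W[OF assms(2) x] map_eta_W[OF d x] map_eta_W[OF d map_swap_W[OF assms(2) x]]
      map_swap_W[OF assms(2) map_eta_W[OF d x]]
    show "A x \<in> words S m" "B x \<in> words S m" using x_W by (cases b; simp only: A_def B_def if_True if_False)+
    show "B (A x) = x" "A (B x) = x"
      using x_W map_swap_swap[OF assms(2)] map_eta_eta[OF d]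
      by (cases b; simp only: A_def B_def if_True if_False)+
  qed simp
  finally show ?thesis .
qed

lemma sum_face_weight_powr_le:
  assumes H: "symmetric_flow m H f" and "k < d" "q > 0" "m \<ge> 1"
  shows "(\<Sum>x\<in>face b k m. \<bar>face_weight m f b k x\<bar> powr q)
    \<le> real (d * (2 * card S)) powr q * pair_energy (words S m) q H"
proof -
  have d: "0 < d" using d_ge_1 by simp
  have "(\<Sum>x\<in>face b k m. \<bar>face_weight m f b k x\<bar> powr q) = (\<Sum>x\<in>words S m. \<bar>f x\<bar> powr q)"
    using sum_face_weight[OF H assms(2), of "\<lambda>r. \<bar>r\<bar> powr q"] by simp
  \<comment> \<open>At a word in the support of \<open>f\<close> the flipped word lies in the
    opposite face, where \<open>f\<close> vanishes, so the divergence of \<open>H\<close> is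
    \<open>f x\<close> itself.\<close>
  also have "\<dots> \<le> (\<Sum>x\<in>words S m. \<bar>outflow (words S m) H x\<bar> powr q)"
  proof (rule sum_mono)
    fix x assume x: "x \<in> words S m"
    show "\<bar>f x\<bar> powr q \<le> \<bar>outflow (words S m) H x\<bar> powr q"
    proof (cases "f x = 0")
      case False
      then have "x \<in> face False 0 m" using H by (auto simp: symmetric_flow_def)
      then have "map (eta L 0) x \<notin> face False 0 m"
        using eta_face[OF d] face_disjoint[OF d assms(4), of False] by fastforce
      then have "f (map (eta L 0) x) = 0" using H by (auto simp: symmetric_flow_def)
      then show ?thesis using H x by (simp add: symmetric_flow_def)
    qed simp
  qed
  also have "\<dots> \<le> real (d * (2 * card S)) powr q * pair_energy (words S m) q H"
    using H assms(3) by (intro outflow_powr_le) (auto simp: symmetric_flow_def)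
  finally show ?thesis .
qed

subsection \<open>The augmented graph\<close>

abbreviation "faces m \<equiv> Lfam {..<d} I m"
abbreviation "aug_V m \<equiv> tilde_V S {..<d} I m"
abbreviation "aug_E m \<equiv> tilde_E S E (cube_tp d) {..<d} I m"

text \<open>Extends a flow on words to the formal edges; \<open>\<beta> K v\<close> is the flow from
  the formal vertex of \<open>v\<close> in \<open>K\<close> into \<open>v\<close>.\<close>

fun aug_flow ::
  "('a list \<Rightarrow> 'a list \<Rightarrow> real) \<Rightarrow> ('a list set \<Rightarrow> 'a list \<Rightarrow> real) \<Rightarrow> 'a tvert \<Rightarrow> 'a tvert \<Rightarrow> real"
where
  "aug_flow H \<beta> (Inl x) (Inl y) = H x y"
| "aug_flow H \<beta> (Inr (K, v)) (Inl y) = (if v = y then \<beta> K v else 0)"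
| "aug_flow H \<beta> (Inl y) (Inr (K, v)) = (if v = y then - \<beta> K v else 0)"
| "aug_flow H \<beta> (Inr _) (Inr _) = 0"

lemma faces_eq: "faces m = (\<lambda>(b, t). face b t m) ` (UNIV \<times> {..<d})"
  by (auto simp: Lfam_def)

lemma finite_faces: "finite (faces m)"
  unfolding faces_eq by simp

lemma faces_sub: "K \<in> faces m \<Longrightarrow> K \<subseteq> words S m"
  using face_sub by (fastforce simp: faces_eq)

lemma finite_face: "K \<in> faces m \<Longrightarrow> finite K"
  by (rule finite_subset[OF faces_sub finite_W])

lemma aug_V_eq: "aug_V m = Inl ` words S m \<union> Inr ` Sigma (faces m) (\<lambda>K. K)"
  by (auto simp: tilde_V_def)

lemma aug_E_eq: "aug_E m = map_prod Inl Inl ` edges m \<union> (\<lambda>(K, v). (Inr (K, v), Inl v)) ` Sigma (faces m) (\<lambda>K. K)"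
  by (force simp: tilde_E_def map_prod_def)

lemma finite_aug_V: "finite (aug_V m)"
  unfolding aug_V_eq using finite_W finite_faces finite_face by auto

lemma sum_aug_V:
  fixes g :: "sym tvert \<Rightarrow> real"
  shows "(\<Sum>y\<in>aug_V m. g y) = (\<Sum>y\<in>words S m. g (Inl y)) + (\<Sum>K\<in>faces m. \<Sum>v\<in>K. g (Inr (K, v)))"
proof -
  have "(\<Sum>y\<in>aug_V m. g y) = (\<Sum>y\<in>Inl ` words S m. g y) + (\<Sum>y\<in>Inr ` Sigma (faces m) (\<lambda>K. K). g y)"
    unfolding aug_V_eq using finite_W finite_faces finite_face by (intro sum.union_disjoint) auto
  also have "(\<Sum>y\<in>Inr ` Sigma (faces m) (\<lambda>K. K). g y) = (\<Sum>K\<in>faces m. \<Sum>v\<in>K. g (Inr (K, v)))"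
    using finite_faces finite_face by (subst sum.Sigma) (auto simp: sum.reindex case_prod_beta)
  finally show ?thesis by (simp add: sum.reindex)
qed

lemma outflow_aug_Inr:
  assumes "K \<in> faces m" "v \<in> K"
  shows "outflow (aug_V m) (aug_flow H \<beta>) (Inr (K, v)) = \<beta> K v"
proof -
  have "v \<in> words S m" using assms faces_sub by blast
  then show ?thesis unfolding outflow_def sum_aug_V using finite_W by simp
qed

lemma outflow_aug_Inl:
  assumes "\<And>K v. \<beta> K v \<noteq> 0 \<Longrightarrow> v \<in> K"
  shows "outflow (aug_V m) (aug_flow H \<beta>) (Inl x) = outflow (words S m) H x - (\<Sum>K\<in>faces m. \<beta> K x)"
proof -
  have "(\<Sum>v\<in>K. aug_flow H \<beta> (Inl x) (Inr (K, v))) = - \<beta> K x" if "K \<in> faces m" for K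
    using finite_face[OF that] assms[of K x] by auto
  then show ?thesis unfolding outflow_def sum_aug_V by (simp add: sum_negf)
qed

lemma edge_flow_aug:
  assumes H: "edge_flow (edges m) H" and "\<And>K v. \<beta> K v \<noteq> 0 \<Longrightarrow> K \<in> faces m \<and> v \<in> K"
  shows "edge_flow (aug_E m) (aug_flow H \<beta>)"
  unfolding edge_flow_def
proof (intro conjI allI impI)
  fix x y :: "sym tvert"
  show "aug_flow H \<beta> x y = - aug_flow H \<beta> y x"
    by (cases x; cases y) (auto intro: edge_flow_antisym[OF H])
  assume nadj: "\<not> adj (aug_E m) x y"
  show "aug_flow H \<beta> x y = 0"
  proof (cases x; cases y)
    fix a b assume xy: "x = Inl a" "y = Inl b"
    then have "\<not> adj (edges m) a b" using nadj by (force simp: adj_def aug_E_eq)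
    then show ?thesis using xy edge_flow_zero[OF H] by simp
  next
    fix a b assume xy: "x = Inr a" "y = Inl b"
    obtain K v where a: "a = (K, v)" by (cases a)
    show ?thesis using nadj assms(2)[of K v] unfolding xy a by (force simp: adj_def aug_E_eq)
  next
    fix a b assume xy: "x = Inl a" "y = Inr b"
    obtain K v where b: "b = (K, v)" by (cases b)
    show ?thesis using nadj assms(2)[of K v] unfolding xy b by (force simp: adj_def aug_E_eq)
  qed simp
qed

lemma energy_aug_le:
  "energy (aug_E m) q (aug_flow H \<beta>)
    \<le> pair_energy (words S m) q H + (\<Sum>K\<in>faces m. \<Sum>v\<in>K. \<bar>\<beta> K v\<bar> powr q)"
proof -
  let ?g = "\<lambda>e. \<bar>aug_flow H \<beta> (fst e) (snd e)\<bar> powr q"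
  let ?B = "Sigma (faces m) (\<lambda>K. K)" and ?j = "\<lambda>(K, v). (Inr (K, v), Inl v)"
  have fin: "finite (edges m)" using edges_sub finite_W finite_subset by blast
  have "energy (aug_E m) q (aug_flow H \<beta>) = sum ?g (map_prod Inl Inl ` edges m) + sum ?g (?j ` ?B)"
    unfolding energy_def aug_E_eq using fin finite_faces finite_face
    by (intro sum.union_disjoint) auto
  also have "sum ?g (map_prod Inl Inl ` edges m) = energy (edges m) q H"
    unfolding energy_def by (subst sum.reindex) (auto simp: inj_on_def)
  also have "sum ?g (?j ` ?B) = (\<Sum>(K, v)\<in>?B. \<bar>\<beta> K v\<bar> powr q)"
    by (subst sum.reindex) (auto simp: inj_on_def intro!: sum.cong)
  also have "\<dots> = (\<Sum>K\<in>faces m. \<Sum>v\<in>K. \<bar>\<beta> K v\<bar> powr q)"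
    using finite_faces finite_face by (subst sum.Sigma) auto
  finally show ?thesis
    using energy_le_pair_energy[OF finite_W edges_sub, of m q H] by simp
qed

text \<open>The formal edges at \<open>K1\<close> feed in \<open>f1\<close> and those at
  \<open>K2\<close> carry off \<open>f2\<close>, which balances the divergence of \<open>H\<close>
  at every word.\<close>

lemma unit_flow_aug:
  assumes K: "K1 \<in> faces m" "K2 \<in> faces m" "K1 \<noteq> K2"
    and H: "edge_flow (edges m) H" "\<forall>x\<in>words S m. outflow (words S m) H x = f1 x - f2 x"
    and f: "\<forall>x. f1 x \<noteq> 0 \<longrightarrow> x \<in> K1" "\<forall>x. f2 x \<noteq> 0 \<longrightarrow> x \<in> K2" "(\<Sum>x\<in>K1. f1 x) = 1"
    and ne: "K1 \<noteq> {}" "K2 \<noteq> {}"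
  defines "\<beta> \<equiv> \<lambda>K v. if K = K1 then f1 v else if K = K2 then - f2 v else 0"
  shows "unit_flow (aug_V m) (aug_E m) (tildeL K1) (tildeL K2) (aug_flow H \<beta>)"
    and "energy (aug_E m) q (aug_flow H \<beta>)
      \<le> pair_energy (words S m) q H + (\<Sum>x\<in>K1. \<bar>f1 x\<bar> powr q) + (\<Sum>x\<in>K2. \<bar>f2 x\<bar> powr q)"
proof -
  have \<beta>: "K \<in> faces m \<and> v \<in> K" if "\<beta> K v \<noteq> 0" for K v
    using that K f by (auto simp: \<beta>_def split: if_splits)
  have sum_faces: "(\<Sum>K\<in>faces m. G K) = G K1 + G K2" if "\<And>K. K \<noteq> K1 \<Longrightarrow> K \<noteq> K2 \<Longrightarrow> G K = 0" for G :: "_ \<Rightarrow> real"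
  proof -
    have "(\<Sum>K\<in>faces m. G K) = (\<Sum>K\<in>{K1, K2}. G K)"
      using K that finite_faces by (intro sum.mono_neutral_right) auto
    then show ?thesis using K by simp
  qed
  have "outflow (aug_V m) (aug_flow H \<beta>) z = 0" if z: "z \<in> aug_V m - (tildeL K1 \<union> tildeL K2)" for z
  proof (cases z)
    case (Inl x)
    then have x: "x \<in> words S m" using z by (auto simp: aug_V_eq)
    have "(\<Sum>K\<in>faces m. \<beta> K x) = f1 x - f2 x"
      using K by (subst sum_faces) (auto simp: \<beta>_def)
    then show ?thesis using outflow_aug_Inl[of \<beta> m H x] \<beta> H(2) x Inl by simp
  next
    case (Inr Kv)
    then obtain K v where Kv: "z = Inr (K, v)" "K \<in> faces m" "v \<in> K" using z by (auto simp: aug_V_eq)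
    then show ?thesis using z outflow_aug_Inr[OF Kv(2,3)] by (auto simp: tildeL_def \<beta>_def)
  qed
  moreover have "(\<Sum>z\<in>tildeL K1. outflow (aug_V m) (aug_flow H \<beta>) z) = 1"
  proof -
    have "(\<Sum>z\<in>tildeL K1. outflow (aug_V m) (aug_flow H \<beta>) z) = (\<Sum>x\<in>K1. f1 x)"
      unfolding tildeL_def using outflow_aug_Inr[OF K(1)]
      by (intro sum.reindex_bij_witness[where i = "\<lambda>x. Inr (K1, x)" and j = "\<lambda>z. snd (projr z)"])
        (auto simp: \<beta>_def)
    then show ?thesis using f by simp
  qed
  moreover have "tildeL K1 \<subseteq> aug_V m" "tildeL K2 \<subseteq> aug_V m" "tildeL K1 \<noteq> {}" "tildeL K2 \<noteq> {}"
    "tildeL K1 \<inter> tildeL K2 = {}"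
    using K ne by (auto simp: tildeL_def aug_V_eq)
  ultimately show "unit_flow (aug_V m) (aug_E m) (tildeL K1) (tildeL K2) (aug_flow H \<beta>)"
    unfolding unit_flow_iff[OF finite_aug_V] using edge_flow_aug[OF H(1) \<beta>] by simp
  have "(\<Sum>K\<in>faces m. \<Sum>v\<in>K. \<bar>\<beta> K v\<bar> powr q) = (\<Sum>x\<in>K1. \<bar>f1 x\<bar> powr q) + (\<Sum>x\<in>K2. \<bar>f2 x\<bar> powr q)"
    using K by (subst sum_faces) (auto simp: \<beta>_def)
  then show "energy (aug_E m) q (aug_flow H \<beta>)
      \<le> pair_energy (words S m) q H + (\<Sum>x\<in>K1. \<bar>f1 x\<bar> powr q) + (\<Sum>x\<in>K2. \<bar>f2 x\<bar> powr q)"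
    using energy_aug_le[of m q H \<beta>] by simp
qed

section \<open>Assembly of the flow basis\<close>

lemma face_weight_eta:
  assumes H: "symmetric_flow m H f" and k: "k < d" and x: "x \<in> words S m"
  shows "face_weight m f (\<not> b) k (map (eta L k) x) = face_weight m f b k x"
proof -
  have d: "0 < d" using d_ge_1 by simp
  show ?thesis
    unfolding face_weight_eq[OF H k x] face_weight_eq[OF H k map_eta_W[OF k x]]
      map_swap_eta[OF k x] map_eta_eta[OF d map_swap_W[OF k x]] by simp
qed

text \<open>First summand: the difference of two flows to the root, each with the factor
  \<open>2 powr q * (2 * 4 powr q)\<close>. Second summand: the formal edges at the two
  faces.\<close>

definition basis_const :: "real \<Rightarrow> real" where
  "basis_const q = 2 powr q * (2 * (2 powr q * (2 * 4 powr q))) + 2 * real (d * (2 * card S)) powr q"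

lemma exists_flow_basis:
  assumes H: "symmetric_flow m H f" and q: "q > 0" and m: "m \<ge> 1"
  shows "\<exists>Fb. flow_basis S E (cube_tp d) {..<d} I (eta L) m Fb \<and>
    fb_energy S E (cube_tp d) {..<d} I m q Fb \<le> basis_const q * pair_energy (words S m) q H"
proof -
  let ?W = "words S m" and ?e = "pair_energy (words S m) q H"
  \<comment> \<open>The basis is indexed by sets of words; as \<open>m \<ge> 1\<close>, different
    pairs of sign and type give different faces, so the pair can be recovered from the set.\<close>
  define idx where "idx = inv_into (UNIV \<times> {..<d}) (\<lambda>(b, t). face b t m)"
  have "inj_on (\<lambda>(b, t). face b t m) (UNIV \<times> {..<d})"
    using face_inj m by (fastforce simp: inj_on_def)
  then have idx: "idx (face b t m) = (b, t)" if "t < d" for b t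
    unfolding idx_def using inv_into_f_f[of "\<lambda>(b, t). face b t m" "UNIV \<times> {..<d}" "(b, t)"] that by simp
  define h where "h b k = (SOME h. edge_flow (edges m) h \<and>
    (\<forall>x\<in>?W. outflow ?W h x = face_weight m f b k x - f x) \<and>
    pair_energy ?W q h \<le> 2 powr q * (2 * 4 powr q) * ?e)" for b k
  have h: "edge_flow (edges m) (h b k) \<and>
    (\<forall>x\<in>?W. outflow ?W (h b k) x = face_weight m f b k x - f x) \<and>
    pair_energy ?W q (h b k) \<le> 2 powr q * (2 * 4 powr q) * ?e" if "k < d" for b k
    unfolding h_def by (rule someI_ex[OF exists_flow_to_root[OF H q that]])
  define g where "g K = (case idx K of (b, k) \<Rightarrow> face_weight m f b k)" for K
  define hK where "hK K = (case idx K of (b, k) \<Rightarrow> h b k)" for K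
  \<comment> \<open>The boundary value at a face depends on this face alone, so the agreement
    conditions between different members hold by construction.\<close>
  define Fb where "Fb K1 K2 = aug_flow (\<lambda>x y. hK K1 x y - hK K2 x y)
     (\<lambda>K v. if K = K1 then g K1 v else if K = K2 then - g K2 v else 0)" for K1 K2
  have face_cases: "\<exists>b k. k < d \<and> K = face b k m \<and> g K = face_weight m f b k \<and> hK K = h b k"
    if K: "K \<in> faces m" for K
  proof -
    obtain b k where "k < d" "K = face b k m" using K by (auto simp: Lfam_def)
    then show ?thesis using idx[of k b] by (intro exI[of _ b] exI[of _ k]) (simp add: g_def hK_def)
  qed
  have *: "unit_flow (aug_V m) (aug_E m) (tildeL K1) (tildeL K2) (Fb K1 K2) \<and>
      energy (aug_E m) q (Fb K1 K2) \<le> basis_const q * ?e"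
    if K: "K1 \<in> faces m" "K2 \<in> faces m" "K1 \<noteq> K2" for K1 K2
  proof -
    obtain b1 k1 where 1: "k1 < d" "K1 = face b1 k1 m" "g K1 = face_weight m f b1 k1" "hK K1 = h b1 k1"
      using face_cases[OF K(1)] by blast
    obtain b2 k2 where 2: "k2 < d" "K2 = face b2 k2 m" "g K2 = face_weight m f b2 k2" "hK K2 = h b2 k2"
      using face_cases[OF K(2)] by blast
    let ?H = "\<lambda>x y. hK K1 x y - hK K2 x y"
    have ef: "edge_flow (edges m) ?H" unfolding 1(3,4) 2(3,4) using h 1(1) 2(1) by (intro edge_flow_diff) auto
    have out: "\<forall>x\<in>?W. outflow ?W ?H x = g K1 x - g K2 x"
      unfolding outflow_diff unfolding 1(3,4) 2(3,4) using h[OF 1(1)] h[OF 2(1)] by simp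
    have supp: "\<forall>x. g K1 x \<noteq> 0 \<longrightarrow> x \<in> K1" "\<forall>x. g K2 x \<noteq> 0 \<longrightarrow> x \<in> K2"
      unfolding 1(3) 2(3) unfolding 1(2) 2(2) by (simp_all add: face_weight_def)
    have "(\<Sum>x\<in>K1. g K1 x) = 1"
      using sum_face_weight[OF H 1(1), of "\<lambda>r. r" b1] H unfolding 1(3) unfolding 1(2) by (simp add: symmetric_flow_def)
    moreover have "K1 \<noteq> {}" "K2 \<noteq> {}" using face_ne 1 2 by auto
    ultimately have unit: "unit_flow (aug_V m) (aug_E m) (tildeL K1) (tildeL K2) (Fb K1 K2)"
      "energy (aug_E m) q (Fb K1 K2)
        \<le> pair_energy ?W q ?H + (\<Sum>x\<in>K1. \<bar>g K1 x\<bar> powr q) + (\<Sum>x\<in>K2. \<bar>g K2 x\<bar> powr q)"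
      unfolding Fb_def by (rule unit_flow_aug[OF K ef out supp]; assumption)+
    have w: "(\<Sum>x\<in>K1. \<bar>g K1 x\<bar> powr q) \<le> real (d * (2 * card S)) powr q * ?e"
      "(\<Sum>x\<in>K2. \<bar>g K2 x\<bar> powr q) \<le> real (d * (2 * card S)) powr q * ?e"
      unfolding 1(3) 2(3) unfolding 1(2) 2(2) by (rule sum_face_weight_powr_le[OF H _ q m], rule 1 2)+
    have "pair_energy ?W q ?H \<le> 2 powr q * (pair_energy ?W q (hK K1) + pair_energy ?W q (hK K2))"
      by (rule pair_energy_diff_le[OF q])
    also have "\<dots> \<le> 2 powr q * (2 powr q * (2 * 4 powr q) * ?e + 2 powr q * (2 * 4 powr q) * ?e)"
      unfolding 1(3,4) 2(3,4) using h 1(1) 2(1) by (intro mult_left_mono add_mono) auto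
    finally have "pair_energy ?W q ?H \<le> 2 powr q * (2 * (2 powr q * (2 * 4 powr q))) * ?e"
      by (simp add: algebra_simps)
    then have "energy (aug_E m) q (Fb K1 K2) \<le> basis_const q * ?e"
      using unit(2) w by (simp add: basis_const_def algebra_simps)
    then show ?thesis using unit(1) by simp
  qed
  have "flow_basis S E (cube_tp d) {..<d} I (eta L) m Fb"
    unfolding flow_basis_def Let_def
  proof (intro conjI ballI allI impI)
    fix t b v assume t: "t \<in> {..<d}" and ne: "face b t m \<noteq> face (\<not> b) t m" and v: "v \<in> face b t m"
    have tW: "t < d" "v \<in> ?W" using t v face_sub by auto
    have g: "g (face c t m) = face_weight m f c t" for c using idx[OF tW(1)] by (simp add: g_def)
    \<comment> \<open>Opposite faces carry mirror-image weights, which is the flip condition for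
      type \<open>t\<close>.\<close>
    show "Fb (face b t m) (face (\<not> b) t m) (Inr (face b t m, v)) (Inl v) =
      Fb (face b t m) (face (\<not> b) t m) (Inl (map (eta L t) v)) (Inr (face (\<not> b) t m, map (eta L t) v))"
      using ne face_weight_eta[OF H tW, of b] by (simp add: Fb_def g)
    show "Fb (face b t m) (face (\<not> b) t m) (Inr (face b t m, v)) (Inl v) =
      Fb (face (\<not> b) t m) (face b t m) (Inl v) (Inr (face b t m, v))"
      using ne by (simp add: Fb_def g)
  qed (use * in \<open>auto simp: Fb_def\<close>)
  moreover have "fb_energy S E (cube_tp d) {..<d} I m q Fb \<le> basis_const q * ?e"
  proof -
    let ?X = "{energy (aug_E m) q (Fb K1 K2) | K1 K2. K1 \<in> faces m \<and> K2 \<in> faces m \<and> K1 \<noteq> K2}"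
    have "?X \<subseteq> (\<lambda>(K1, K2). energy (aug_E m) q (Fb K1 K2)) ` (faces m \<times> faces m)" by auto
    then have "finite ?X" using finite_faces by (meson finite_SigmaI finite_imageI finite_subset)
    moreover have "?X \<noteq> {}"
    proof -
      have d: "0 < d" using d_ge_1 by simp
      have "face True 0 m \<in> faces m" "face False 0 m \<in> faces m" using d by (auto simp: Lfam_def)
      moreover have "face True 0 m \<noteq> face False 0 m" using face_inj[OF _ d d m] by blast
      ultimately show ?thesis by blast
    qed
    ultimately show ?thesis
      unfolding fb_energy_def using * by (subst Max_le_iff) auto
  qed
  ultimately show ?thesis by blast
qed

section \<open>Comparison of the types and near-minimal flows\<close>

lemma min_energy_swap_le:
  assumes k: "k < d" and q: "q > 0" and m: "m \<ge> 1"
  shows "min_energy (words S m) (edges m) q (face False 0 m) (face True 0 m)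
    \<le> 4 powr q * 2 * min_energy (words S m) (edges m) q (face False k m) (face True k m)"
proof -
  have d: "0 < d" using d_ge_1 by simp
  let ?W = "words S m" and ?swap = "map (swap k)"
  let ?M = "min_energy ?W (edges m) q (face False 0 m) (face True 0 m)"
  have "?M / (4 powr q * 2) \<le> energy (edges m) q F"
    if F: "unit_flow ?W (edges m) (face False k m) (face True k m) F" for F
  proof -
    have ef: "edge_flow (edges m) F"
      and F0: "\<And>x. x \<in> ?W \<Longrightarrow> x \<notin> face False k m \<Longrightarrow> x \<notin> face True k m \<Longrightarrow> outflow ?W F x = 0"
      and F1: "(\<Sum>x\<in>face False k m. outflow ?W F x) = 1"
      using F unfolding unit_flow_iff[OF finite_W] by auto
    have "\<forall>x\<in>?W. ?swap x \<in> ?W" "\<forall>x\<in>?W. ?swap (?swap x) = x"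
      "\<forall>u v. adj (edges m) u v \<longrightarrow> adj (edges m) (?swap u) (?swap v)"
      using map_swap_W[OF k] map_swap_swap[OF k] swap_adj[OF k] by blast+
    note push = push_involution[OF ef q this]
    \<comment> \<open>The swap turns a competitor for type \<open>k\<close> into one for type
      \<open>0\<close>; this makes the final constant independent of the type.\<close>
    let ?G = "push_flow ?W ?swap F"
    have "outflow ?W ?G x = 0" if x: "x \<in> ?W - (face False 0 m \<union> face True 0 m)" for x
    proof -
      have W: "x \<in> ?W" using x by blast
      have "?swap x \<notin> face b k m" for b
        using swap_face(2)[OF k, of "?swap x" b m] map_swap_swap[OF k W] x by (cases b) auto
      then show ?thesis using push(2)[OF W] F0[OF map_swap_W[OF k W]] by simp
    qed
    moreover have "(\<Sum>x\<in>face False 0 m. outflow ?W ?G x) = 1"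
    proof -
      have "(\<Sum>x\<in>face False 0 m. outflow ?W ?G x) = (\<Sum>x\<in>face False k m. outflow ?W F x)"
      proof (rule sum.reindex_bij_witness[where i = ?swap and j = ?swap])
        fix x assume x: "x \<in> face False 0 m"
        then have W: "x \<in> ?W" using face_sub[OF d] by blast
        show "?swap (?swap x) = x" by (rule map_swap_swap[OF k W])
        show "?swap x \<in> face False k m" by (rule swap_face(1)[OF k x])
        show "outflow ?W F (?swap x) = outflow ?W ?G x" by (rule push(2)[OF W, symmetric])
      next
        fix x assume x: "x \<in> face False k m"
        then have W: "x \<in> ?W" using face_sub[OF k] by blast
        show "?swap (?swap x) = x" by (rule map_swap_swap[OF k W])
        show "?swap x \<in> face False 0 m" by (rule swap_face(2)[OF k x])
      qed
      then show ?thesis using F1 by simp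
    qed
    moreover have "face False 0 m \<inter> face True 0 m = {}" using face_disjoint[OF d m, of False] by simp
    ultimately have "unit_flow ?W (edges m) (face False 0 m) (face True 0 m) ?G"
      unfolding unit_flow_iff[OF finite_W] using push(1) face_sub[OF d] face_ne[OF d]
      by (intro conjI ballI) simp_all
    then have "?M \<le> energy (edges m) q ?G" by (rule min_energy_le)
    also have "\<dots> \<le> pair_energy ?W q ?G" by (rule energy_le_pair_energy[OF finite_W edges_sub])
    also have "\<dots> \<le> 4 powr q * pair_energy ?W q F" by (rule push(3))
    also have "\<dots> \<le> 4 powr q * (2 * energy (edges m) q F)"
      using pair_energy_le_energy[OF finite_W edges_sub ef] by (intro mult_left_mono) auto
    finally show ?thesis by (simp add: field_simps)
  qed
  moreover obtain F0 where "unit_flow ?W (edges m) (face False k m) (face True k m) F0"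
    using exists_unit_flow[OF k m] by blast
  ultimately have "?M / (4 powr q * 2) \<le> min_energy ?W (edges m) q (face False k m) (face True k m)"
    by (intro le_min_energy) auto
  then show ?thesis by (simp add: field_simps)
qed

text \<open>The infimum is positive and taken over a nonempty set, so twice its value is not a lower
  bound.\<close>

lemma exists_near_minimal_flow:
  assumes "t < d" "q > 0" "m \<ge> 1"
  shows "\<exists>F. unit_flow (words S m) (edges m) (face False t m) (face True t m) F \<and>
    energy (edges m) q F \<le> 2 * min_energy (words S m) (edges m) q (face False t m) (face True t m)"
proof (rule ccontr)
  let ?M = "min_energy (words S m) (edges m) q (face False t m) (face True t m)"
  assume no: "\<not> ?thesis"
  obtain F0 where F0: "unit_flow (words S m) (edges m) (face False t m) (face True t m) F0"
    using exists_unit_flow[OF assms(1,3)] by blast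
  have "2 * ?M \<le> ?M"
    by (rule le_min_energy[OF F0]) (use no in force)
  then show False using min_energy_pos[OF finite_W edges_sub assms(2) F0] by simp
qed

end

theorem theorem6p12:
  fixes d L s :: nat and S :: "sym set" and E :: "(sym \<times> sym) set"
    and I :: "nat \<Rightarrow> (sym \<times> sym) set" and p q :: real
  assumes "d \<ge> 1" and "s \<ge> 1" and "L \<ge> 3"
    and "cubical_IGS d L s S E I"
    and "p > 1" and "q = p / (p - 1)"
  shows "\<exists>C_FB > 0. \<forall>m \<ge> 1. \<exists>Fb.
           flow_basis S E (cube_tp d) {..<d} I (eta L) m Fb \<and>
           (\<forall>t < d. fb_energy S E (cube_tp d) {..<d} I m q Fb
              \<le> C_FB * min_energy (words S m) (rep_edges S E (cube_tp d) I m) q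
                          (Iside I False t m) (Iside I True t m))"
proof -
  interpret cubical d L s S E I by unfold_locales (use assms in auto)
  have q: "q > 0" using assms by simp
  have d: "0 < d" using assms by simp
  \<comment> \<open>\<open>K\<close> collects the losses of symmetrisation and assembly. In
    \<open>C\<close> a factor \<open>2\<close> accounts for counting both orientations, another
    \<open>2\<close> for near-minimality, and \<open>4 powr q * 2\<close> for passing from type
    \<open>0\<close> to type \<open>t\<close>.\<close>
  define K where "K = basis_const q * (2 powr q * (1 + 4 powr q))"
  define C where "C = K * (2 * (2 * (4 powr q * 2)))"
  have K: "K > 0" unfolding K_def basis_const_def by (intro mult_pos_pos add_pos_nonneg) auto
  then have "C > 0" by (simp add: C_def)
  moreover have "\<exists>Fb. flow_basis S E (cube_tp d) {..<d} I (eta L) m Fb \<and>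
      (\<forall>t<d. fb_energy S E (cube_tp d) {..<d} I m q Fb
        \<le> C * min_energy (words S m) (edges m) q (face False t m) (face True t m))"
    if m: "m \<ge> 1" for m
  proof -
    let ?W = "words S m"
    let ?M = "\<lambda>t. min_energy ?W (edges m) q (face False t m) (face True t m)"
    obtain F where F: "unit_flow ?W (edges m) (face False 0 m) (face True 0 m) F"
      "energy (edges m) q F \<le> 2 * ?M 0"
      using exists_near_minimal_flow[OF d q m] by blast
    obtain H f where H: "symmetric_flow m H f"
      "pair_energy ?W q H \<le> 2 powr q * (1 + 4 powr q) * pair_energy ?W q F"
      using exists_symmetric_flow[OF F(1) q m] by blast
    obtain Fb where Fb: "flow_basis S E (cube_tp d) {..<d} I (eta L) m Fb"
      "fb_energy S E (cube_tp d) {..<d} I m q Fb \<le> basis_const q * pair_energy ?W q H"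
      using exists_flow_basis[OF H(1) q m] by blast
    have "fb_energy S E (cube_tp d) {..<d} I m q Fb \<le> C * ?M t" if t: "t < d" for t
    proof -
      have "basis_const q * pair_energy ?W q H \<le> K * pair_energy ?W q F"
        unfolding K_def mult.assoc[of "basis_const q"] using H(2)
        by (intro mult_left_mono) (auto simp: basis_const_def)
      moreover have "K * pair_energy ?W q F \<le> K * (2 * energy (edges m) q F)"
        using K pair_energy_le_energy[OF finite_W edges_sub] F(1)
        by (intro mult_left_mono) (auto simp: unit_flow_iff[OF finite_W])
      moreover have "K * (2 * energy (edges m) q F) \<le> K * (2 * (2 * (4 powr q * 2 * ?M t)))"
        using K F(2) min_energy_swap_le[OF t q m] by (intro mult_left_mono) auto
      ultimately show ?thesis using Fb(2) by (simp add: C_def mult.assoc)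
    qed
    then show ?thesis using Fb(1) by blast
  qed
  ultimately show ?thesis by blast
qed

end
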